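(* Let $\nu>-1$. The function $h_\nu(z)=2^{\nu}\Gamma(\nu+1)z^{1-\frac{\nu}{2}}J_\nu(\sqrt z)$ is uniformly convex in the open unit disk $U$ if and only if $\nu>\nu_{3}\simeq0.30608\ldots$, where $\nu_{3}$ is the unique root of the equation $$(2\nu-3)J_{\nu+1}(1)+J_{\nu}(1)=0$$ situated in $[0,\infty)$.
   Context: $J_\nu$ is the Bessel function of the first kind of order $\nu$: $J_{\nu}(z)=\sum_{n\ge 0}\frac{(-1)^{n}}{n!\,\Gamma(n+\nu+1)}\left(\frac z2\right)^{2n+\nu}$. The normalized function is $h_\nu(z)=2^{\nu}\Gamma(\nu+1)z^{1-\frac{\nu}{2}}J_\nu(\sqrt z)=z-\frac{1}{4(\nu+1)}z^{2}+\dots$ (an entire function). $U=\{z\in\mathbb C:|z|<1\}$. A function $f(z)=z+\sum_{n\ge2}a_nz^n$ is uniformly convex in $U$ if it is analytic in $U$, convex there (univalent with convex image), and for every circular arc $\gamma$ contained in $U$ with center also in $U$, the arc $f(\gamma)$ is convex. Equivalently (Rønning's characterization), $f$ is analytic in $U$ and $\operatorname{Re}\left(1+\frac{zf''(z)}{f'(z)}\right)>\left|\frac{zf''(z)}{f'(z)}\right|$ for all $z\in U$.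
   Formalization: The condition ν>ν₃ is replaced by ν≥ν₃: at ν=ν₃ one has |zh''/h'|≤|z|/2<1/2 throughout the open disk U, so h_{ν₃} is uniformly convex there and the strict inequality in the "only if" part fails at that single value. *)

theory Defs
  imports "HOL-Analysis.Analysis"
begin

text \<open>
  Bessel function of the first kind of real order, on the principal branch of the power
  \<open>(z/2)\<^sup>\<nu>\<close>. The case distinction makes \<open>J\<^sub>0(0) = 1\<close>, since \<open>0 powr 0 = 0\<close> in HOL.
\<close>

definition bessel_J :: "real \<Rightarrow> complex \<Rightarrow> complex" where
  "bessel_J \<nu> z =
     (if \<nu> = 0 then 1 else (z / 2) powr of_real \<nu>) *
     (\<Sum>n. of_real ((-1) ^ n / (fact n * Gamma (real n + \<nu> + 1))) * (z / 2) ^ (2 * n))"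

text \<open>
  All powers are principal, so that the branches of \<open>z\<^bsup>1-\<nu>/2\<^esup>\<close> and \<open>J\<^sub>\<nu>(\<surd>z)\<close> cancel, also on
  the negative real axis and, because \<open>0 powr a = 0\<close>, at the removable singularity \<open>0\<close>.
\<close>

definition bessel_h :: "real \<Rightarrow> complex \<Rightarrow> complex" where
  "bessel_h \<nu> z =
     of_real (2 powr \<nu> * Gamma (\<nu> + 1)) * z powr of_real (1 - \<nu> / 2) * bessel_J \<nu> (csqrt z)"

text \<open>
  A regular parametrized arc is convex if it has a continuous argument of the tangent that is
  nondecreasing along the arc (Goodman's convention: the tangent turns counterclockwise).
\<close>

definition convex_arc :: "(real \<Rightarrow> complex) \<Rightarrow> real \<Rightarrow> real \<Rightarrow> bool" where
  "convex_arc w a b \<longleftrightarrow>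
     (\<exists>\<theta>. continuous_on {a..b} \<theta> \<and> mono_on {a..b} \<theta> \<and>
        (\<forall>t\<in>{a..b}. \<exists>\<rho>>0. (w has_vector_derivative of_real \<rho> * cis (\<theta> t)) (at t within {a..b})))"

text \<open>
  Goodman's uniform convexity in the open unit disk, for functions normalized by
  \<open>f(z) = z + a\<^sub>2z\<^sup>2 + \<dots>\<close>. Circular arcs are traversed counterclockwise.
\<close>

definition uniformly_convex :: "(complex \<Rightarrow> complex) \<Rightarrow> bool" where
  "uniformly_convex f \<longleftrightarrow>
     f holomorphic_on ball 0 1 \<and> f 0 = 0 \<and> deriv f 0 = 1 \<and>
     inj_on f (ball 0 1) \<and> convex (f ` ball 0 1) \<and>
     (\<forall>\<zeta>\<in>ball 0 1. \<forall>r>0. \<forall>a b. a < b \<and> b \<le> a + 2 * pi \<and>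
        (\<forall>t\<in>{a..b}. \<zeta> + of_real r * cis t \<in> ball 0 1) \<longrightarrow>
        convex_arc (\<lambda>t. f (\<zeta> + of_real r * cis t)) a b)"

end

theory Submission
  imports Defs "HOL-Complex_Analysis.Conformal_Mappings"
begin

text \<open>
  Write \<open>h = h\<^sub>\<nu> = z \<phi>(z)\<close> and \<open>q = - z \<phi>'/\<phi>\<close>. The Bessel equation turns into the Riccati equation
  \<open>4 z q' + 4 \<nu> q = 4 q\<^sup>2 + z\<close>, so all Taylor coefficients of \<open>q\<close> are nonnegative. Since
  \<open>- z h''/h' = q + z q'/(1 - q)\<close>, the same holds for \<open>- h''/h'\<close>, which therefore attains its maximum
  modulus on the closed disk at \<open>1\<close>. If \<open>h'(1) + 2 h''(1) \<ge> 0\<close>, it follows that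
  \<open>|h''/h'| \<le> 1/2\<close> in the disk, and \<open>Re (1 + (z - \<zeta>) h''(z)/h'(z)) \<ge> 0\<close> for all \<open>z, \<zeta>\<close> in it.
  Conversely, arcs around \<open>- x\<close> through \<open>x\<close> force \<open>h'(x) + 2 x h''(x) \<ge> 0\<close>, and \<open>x \<rightarrow> 1\<close> gives the
  same condition at \<open>1\<close>. By the Bessel equation, \<open>h'(1) + 2 h''(1)\<close> is a positive multiple of
  \<open>(2\<nu> - 3) J\<^bsub>\<nu>+1\<^esub>(1) + J\<^sub>\<nu>(1)\<close>, and \<open>(\<nu> + 1) (h'(1) + 2 h''(1))\<close> is strictly increasing in \<open>\<nu>\<close>.
\<close>

subsection \<open>Convexity of images and arcs\<close>

text \<open>A segment with endpoints in \<open>S\<close> that leaves \<open>S\<close> meets the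
  frontier in some \<open>v\<close>. As \<open>S\<close> is open, the support inequality at
  \<open>v\<close> is strict on \<open>S\<close>, in particular at both endpoints, although
  \<open>v\<close> is a convex combination of them.\<close>

lemma convex_open_if_supported:
  fixes S :: "'a::euclidean_space set"
  assumes "open S"
    and supp: "\<And>v. v \<in> frontier S \<Longrightarrow> \<exists>d. d \<noteq> 0 \<and> (\<forall>y\<in>S. d \<bullet> y \<le> d \<bullet> v)"
  shows "convex S"
  unfolding convex_contains_segment
proof (intro ballI subsetI, rule ccontr)
  fix x y w assume x: "x \<in> S" and y: "y \<in> S" and w: "w \<in> closed_segment x y" "w \<notin> S"
  have "closed_segment x y \<inter> frontier S \<noteq> {}"
    using x w by (intro connected_Int_frontier) auto
  then obtain v where v: "v \<in> closed_segment x y" "v \<in> frontier S" by blast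
  obtain d where d: "d \<noteq> 0" "\<And>y. y \<in> S \<Longrightarrow> d \<bullet> y \<le> d \<bullet> v" using supp[OF v(2)] by blast
  have strict: "d \<bullet> u < d \<bullet> v" if "u \<in> S" for u
  proof -
    obtain e where e: "e > 0" "ball u e \<subseteq> S" using \<open>open S\<close> \<open>u \<in> S\<close> openE by blast
    define s where "s = e / (2 * norm d)"
    have "s > 0" using e d by (simp add: s_def)
    have "dist u (u + s *\<^sub>R d) < e" using e d by (simp add: s_def dist_norm)
    then have "d \<bullet> (u + s *\<^sub>R d) \<le> d \<bullet> v" using e d by auto
    moreover have "s * (d \<bullet> d) > 0" using d \<open>s > 0\<close> by simp
    ultimately show ?thesis by (simp add: inner_add_right)
  qed
  obtain t where t: "0 \<le> t" "t \<le> 1" "v = (1 - t) *\<^sub>R x + t *\<^sub>R y"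
    using v(1) unfolding closed_segment_def by blast
  have "d \<bullet> v = (1 - t) * (d \<bullet> x) + t * (d \<bullet> y)" by (simp add: t inner_add_right)
  also have "\<dots> < d \<bullet> v"
    using convex_bound_lt[OF strict[OF x] strict[OF y], of "1 - t" t] t(1,2) by simp
  finally show False by simp
qed

text \<open>On the segment from \<open>w\<close> to \<open>z\<close> the bound on \<open>f2\<close>
  gives \<open>norm (f1 (p t) - f1 w) \<le> M * t * norm (z - w)\<close>; comparison with the
  primitive in \<open>t\<close> produces the factor 1/2.\<close>

lemma norm_taylor_remainder_le:
  fixes f f1 f2 :: "complex \<Rightarrow> complex"
  assumes f: "\<And>z. z \<in> S \<Longrightarrow> (f has_field_derivative f1 z) (at z)"
    and f1: "\<And>z. z \<in> S \<Longrightarrow> (f1 has_field_derivative f2 z) (at z)"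
    and S: "convex S" "w \<in> S" "z \<in> S"
    and M: "\<And>z. z \<in> S \<Longrightarrow> norm (f2 z) \<le> M"
  shows "norm (f z - f w - f1 w * (z - w)) \<le> M * (norm (z - w))\<^sup>2 / 2"
proof -
  define p where "p = (\<lambda>t::real. w + of_real t * (z - w))"
  have p: "p t \<in> S" if "0 \<le> t" "t \<le> 1" for t
  proof -
    have "p t = (1 - t) *\<^sub>R w + t *\<^sub>R z" by (simp add: p_def scaleR_conv_of_real algebra_simps)
    then show ?thesis using S that by (simp add: convexD_alt)
  qed
  define D where "D = (\<lambda>t. f (p t) - f1 w * (of_real t * (z - w)))"
  have pd: "(p has_vector_derivative (z - w)) (at t)" for t
    unfolding p_def by (auto intro!: derivative_eq_intros)
  have D: "(D has_vector_derivative (f1 (p t) - f1 w) * (z - w)) (at t)" if "0 \<le> t" "t \<le> 1" for t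
  proof -
    have "((\<lambda>t. f1 w * (of_real t * (z - w))) has_vector_derivative f1 w * (z - w)) (at t)"
      by (auto intro!: derivative_eq_intros)
    then have "(D has_vector_derivative (z - w) * f1 (p t) - f1 w * (z - w)) (at t)"
      unfolding D_def
      by (intro has_vector_derivative_diff field_vector_diff_chain_at[OF pd, unfolded o_def] f p that)
    then show ?thesis by (simp add: algebra_simps)
  qed
  have b: "norm ((f1 (p t) - f1 w) * (z - w)) \<le> M * (norm (z - w))\<^sup>2 * t" if "0 \<le> t" "t \<le> 1" for t
  proof -
    have "norm (f1 (p t) - f1 w) \<le> M * norm (p t - w)"
      by (rule field_differentiable_bound[of S f1 f2])
         (use f1 M S p that in \<open>auto intro: has_field_derivative_at_within\<close>)
    also have "norm (p t - w) = t * norm (z - w)" using that by (simp add: p_def norm_mult)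
    finally show ?thesis
      by (auto simp: norm_mult power2_eq_square mult_ac dest: mult_right_mono[where c = "norm (z - w)"])
  qed
  have "norm (D 1 - D 0) \<le> M * (norm (z - w))\<^sup>2 * (1\<^sup>2 / 2) - M * (norm (z - w))\<^sup>2 * (0\<^sup>2 / 2)"
  proof (rule differentiable_bound_general[where f' = "\<lambda>t. (f1 (p t) - f1 w) * (z - w)"
        and \<phi>' = "\<lambda>t. M * (norm (z - w))\<^sup>2 * t" and \<phi> = "\<lambda>t. M * (norm (z - w))\<^sup>2 * (t\<^sup>2 / 2)"])
    show "continuous_on {0..1} D"
      using D by (meson atLeastAtMost_iff continuous_at_imp_continuous_on has_vector_derivative_continuous)
    show "((\<lambda>t. M * (norm (z - w))\<^sup>2 * (t\<^sup>2 / 2)) has_vector_derivative M * (norm (z - w))\<^sup>2 * t) (at t)"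
      for t :: real
      unfolding has_real_derivative_iff_has_vector_derivative[symmetric]
      by (auto intro!: derivative_eq_intros)
  qed (use D b in \<open>auto intro!: continuous_intros\<close>)
  then show ?thesis by (simp add: D_def p_def algebra_simps)
qed

text \<open>If the maximum of |f''| on the closed disk does not exceed the minimum of |f'|, the
  Taylor remainder at a boundary point is too small to push the image across the tangent line
  there.\<close>

lemma convex_image_unit_disk:
  fixes f f1 f2 :: "complex \<Rightarrow> complex"
  assumes f: "\<And>z. (f has_field_derivative f1 z) (at z)"
    and f1: "\<And>z. (f1 has_field_derivative f2 z) (at z)"
    and "inj_on f (ball 0 1)" "M > 0"
    and M: "\<And>z. norm z \<le> 1 \<Longrightarrow> norm (f2 z) \<le> M" "\<And>z. norm z \<le> 1 \<Longrightarrow> M \<le> norm (f1 z)"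
  shows "convex (f ` ball 0 1)"
proof (rule convex_open_if_supported)
  have hol: "f holomorphic_on A" for A
    using f by (meson has_field_derivative_at_within holomorphic_onI field_differentiable_def)
  show op: "open (f ` ball 0 1)"
    by (rule open_mapping_thm3) (use hol assms in auto)
  fix v assume v: "v \<in> frontier (f ` ball 0 1)"
  have "compact (f ` cball 0 1)"
    by (intro compact_continuous_image holomorphic_on_imp_continuous_on hol) auto
  then have "closure (f ` ball 0 1) \<subseteq> f ` cball 0 1"
    by (intro closure_minimal compact_imp_closed) auto
  then have "v \<in> f ` cball 0 1 - f ` ball 0 1"
    using v op by (auto simp: frontier_def interior_open)
  then obtain z0 where z0: "norm z0 = 1" "v = f z0"
    by (smt (verit, ccfv_SIG) DiffE dist_0_norm imageE image_eqI mem_ball mem_cball)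
  have nz: "f1 z0 \<noteq> 0" using M(2)[of z0] z0 \<open>M > 0\<close> by auto
  \<comment> \<open>The outward normal at \<open>v\<close>. With \<open>u = z / z0\<close> the
    linear part of \<open>f z - v\<close> is \<open>- d * (1 - u)\<close>; it dominates the
    remainder because |1 - u|^2 \<le> 2 Re (1 - u) for |u| \<le> 1.\<close>
  define d where "d = z0 * f1 z0"
  have "d \<bullet> f z \<le> d \<bullet> v" if z: "z \<in> ball 0 1" for z
  proof -
    define u where "u = z / z0"
    have zu: "z0 - z = z0 * (1 - u)" "norm (z0 - z) = norm (1 - u)"
    proof -
      show *: "z0 - z = z0 * (1 - u)" using z0(1) by (auto simp: u_def field_simps)
      show "norm (z0 - z) = norm (1 - u)" by (simp add: * z0 norm_mult)
    qed
    have "norm u \<le> 1" using z z0 by (simp add: u_def norm_divide)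
    then have "(norm u)\<^sup>2 \<le> 1" by (simp add: power_le_one)
    then have u: "(norm (1 - u))\<^sup>2 \<le> 2 * Re (1 - u)"
      unfolding cmod_power2 by (simp add: power2_eq_square algebra_simps)
    have "norm (f z - f z0 - f1 z0 * (z - z0)) \<le> M * (norm (z - z0))\<^sup>2 / 2"
      by (rule norm_taylor_remainder_le[of "cball 0 1" f f1 f2]) (use f f1 z z0 M in auto)
    also have "\<dots> \<le> norm (f1 z0) * (norm (1 - u))\<^sup>2 / 2"
      using M(2)[of z0] z0(1) by (simp add: norm_minus_commute[of z z0] zu(2) mult_right_mono)
    finally have r: "norm (f z - f z0 - f1 z0 * (z - z0)) \<le> norm (f1 z0) * (norm (1 - u))\<^sup>2 / 2" .
    have nd: "norm d = norm (f1 z0)" by (simp add: d_def norm_mult z0)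
    have "d \<bullet> (f z - f z0) = d \<bullet> (f z - f z0 - f1 z0 * (z - z0)) - d \<bullet> (d * (1 - u))"
    proof -
      have "d * (1 - u) = f1 z0 * (z0 - z)" by (simp add: d_def zu)
      then have "f z - f z0 = (f z - f z0 - f1 z0 * (z - z0)) - d * (1 - u)" by (simp add: algebra_simps)
      then show ?thesis by (metis inner_diff_right)
    qed
    also have "\<dots> \<le> norm d * (norm (f1 z0) * (norm (1 - u))\<^sup>2 / 2) - d \<bullet> (d * (1 - u))"
      using norm_cauchy_schwarz[of d] r by (smt (verit) mult_left_mono norm_ge_zero)
    also have "d \<bullet> (d * (1 - u)) = (norm d)\<^sup>2 * Re (1 - u)"
      unfolding cmod_power2 by (simp add: inner_complex_def power2_eq_square algebra_simps)
    also have "norm d * (norm (f1 z0) * (norm (1 - u))\<^sup>2 / 2) - (norm d)\<^sup>2 * Re (1 - u)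
        = (norm d)\<^sup>2 * ((norm (1 - u))\<^sup>2 / 2 - Re (1 - u))"
      by (simp add: nd power2_eq_square algebra_simps)
    also have "\<dots> \<le> 0" using u by (intro mult_nonneg_nonpos) auto
    finally show ?thesis by (simp add: inner_diff_right z0)
  qed
  then show "\<exists>d. d \<noteq> 0 \<and> (\<forall>y\<in>f ` ball 0 1. d \<bullet> y \<le> d \<bullet> v)"
    using nz z0 by (intro exI[of _ d]) (auto simp: d_def)
qed

section \<open>Images of circular arcs\<close>

lemma circle_has_vector_derivative:
  "((\<lambda>t. \<zeta> + of_real r * cis t) has_vector_derivative of_real r * (\<i> * cis t)) (at t within T)"
proof -
  have "((\<lambda>t. \<zeta> + of_real r * exp (\<i> * of_real t)) has_vector_derivative of_real r * (\<i> * exp (\<i> * of_real t)))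
          (at t within T)"
    by (rule derivative_eq_intros has_vector_derivative_real_field | simp)+
  then show ?thesis by (simp add: cis_conv_exp)
qed

text \<open>The tangent of the image arc has argument
  \<open>t + pi / 2 + Im (Ln (f1 (z t)))\<close>, with derivative 1 + Re ((z - \<zeta>) f''/f').
  This is nonnegative since two points of the disk have distance below 2 and |f''/f'| \<le> 1/2.
  Positivity of \<open>Re (f1 z)\<close> keeps the values of f' off the branch cut of
  \<open>Ln\<close>.\<close>

lemma convex_arc_circle:
  fixes f f1 f2 :: "complex \<Rightarrow> complex"
  assumes f: "\<And>z. z \<in> ball 0 1 \<Longrightarrow> (f has_field_derivative f1 z) (at z)"
    and f1: "\<And>z. z \<in> ball 0 1 \<Longrightarrow> (f1 has_field_derivative f2 z) (at z)"
    and pos: "\<And>z. z \<in> ball 0 1 \<Longrightarrow> Re (f1 z) > 0"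
    and half: "\<And>z. z \<in> ball 0 1 \<Longrightarrow> norm (f2 z) \<le> norm (f1 z) / 2"
    and \<zeta>: "\<zeta> \<in> ball 0 1" and "r > 0"
    and arc: "\<And>t. t \<in> {a..b} \<Longrightarrow> \<zeta> + of_real r * cis t \<in> ball 0 1"
  shows "convex_arc (\<lambda>t. f (\<zeta> + of_real r * cis t)) a b"
proof -
  define z where "z = (\<lambda>t. \<zeta> + of_real r * cis t)"
  define \<theta> where "\<theta> = (\<lambda>t. t + pi / 2 + Im (Ln (f1 (z t))))"
  have z: "(z has_vector_derivative of_real r * (\<i> * cis t)) (at t within T)" for t T
    unfolding z_def by (rule circle_has_vector_derivative)
  have zin: "z t \<in> ball 0 1" if "t \<in> {a..b}" for t using arc[OF that] by (simp add: z_def)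
  have \<theta>': "(\<theta> has_real_derivative 1 + Im (f2 (z t) / f1 (z t) * (of_real r * (\<i> * cis t))))
      (at t within {a..b})" if t: "t \<in> {a..b}" for t
  proof -
    have "((\<lambda>z. Ln (f1 z)) has_field_derivative f2 (z t) / f1 (z t)) (at (z t))"
      using pos[OF zin[OF t]] by (auto intro!: derivative_eq_intros f1 zin t simp: complex_nonpos_Reals_iff field_simps)
    then have "((\<lambda>t. Ln (f1 (z t))) has_vector_derivative
        of_real r * (\<i> * cis t) * (f2 (z t) / f1 (z t))) (at t within {a..b})"
      by (rule field_vector_diff_chain_within[OF z has_field_derivative_at_within, unfolded o_def])
    then have "((\<lambda>t. Im (Ln (f1 (z t)))) has_vector_derivative
        Im (of_real r * (\<i> * cis t) * (f2 (z t) / f1 (z t)))) (at t within {a..b})"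
      by (rule bounded_linear.has_vector_derivative[OF bounded_linear_Im])
    then show ?thesis
      unfolding \<theta>_def has_real_derivative_iff_has_vector_derivative
      by (auto intro!: derivative_eq_intros simp: mult_ac)
  qed
  have nonneg: "1 + Im (f2 (z t) / f1 (z t) * (of_real r * (\<i> * cis t))) \<ge> 0" if t: "t \<in> {a..b}" for t
  proof -
    have "f1 (z t) \<noteq> 0" using pos[OF zin[OF t]] by auto
    then have "norm (f2 (z t) / f1 (z t)) \<le> 1 / 2"
      using half[OF zin[OF t]] by (simp add: norm_divide field_simps)
    moreover have "norm (of_real r * (\<i> * cis t)) \<le> 2"
    proof -
      have "norm (of_real r * (\<i> * cis t)) = norm (z t - \<zeta>)" by (simp add: z_def norm_mult)
      also have "\<dots> \<le> norm (z t) + norm \<zeta>" by (rule norm_triangle_ineq4)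
      finally show ?thesis using zin[OF t] \<zeta> by auto
    qed
    ultimately have "norm (f2 (z t) / f1 (z t) * (of_real r * (\<i> * cis t))) \<le> 1 / 2 * 2"
      unfolding norm_mult[of "f2 (z t) / f1 (z t)"] by (intro mult_mono) auto
    then show ?thesis using abs_Im_le_cmod[of "f2 (z t) / f1 (z t) * (of_real r * (\<i> * cis t))"] by linarith
  qed
  show ?thesis unfolding convex_arc_def
  proof (intro exI conjI ballI)
    show "continuous_on {a..b} \<theta>"
      using \<theta>' by (meson DERIV_continuous continuous_on_eq_continuous_within)
    show "mono_on {a..b} \<theta>"
    proof (rule mono_onI)
      fix s t assume st: "s \<in> {a..b}" "t \<in> {a..b}" "s \<le> t"
      have sub: "{s..t} \<subseteq> {a..b}" using st by auto
      have "continuous_on {s..t} \<theta>"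
        by (rule DERIV_continuous_on[OF DERIV_subset[OF \<theta>' sub]]) (use sub in auto)
      moreover have "\<exists>y. (\<theta> has_real_derivative y) (at x) \<and> y \<ge> 0" if "s < x" "x < t" for x
        using \<theta>'[of x] nonneg[of x] at_within_Icc_at[of a x b] that st by auto
      ultimately show "\<theta> s \<le> \<theta> t"
        by (intro DERIV_nonneg_imp_increasing_open[OF \<open>s \<le> t\<close>])
    qed
    fix t assume t: "t \<in> {a..b}"
    let ?\<rho> = "r * norm (f1 (z t))"
    have nz: "f1 (z t) \<noteq> 0" using pos[OF zin[OF t]] by auto
    show "?\<rho> > 0" using nz \<open>r > 0\<close> by simp
    have "cis (\<theta> t) = cis t * \<i> * cis (Arg (f1 (z t)))"
      by (simp add: \<theta>_def cis_mult[symmetric] Arg_eq_Im_Ln nz)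
    then have e: "of_real ?\<rho> * cis (\<theta> t) = of_real r * (\<i> * cis t) * f1 (z t)"
      using rcis_cmod_Arg[of "f1 (z t)"] by (simp add: rcis_def mult_ac)
    have "((\<lambda>t. f (z t)) has_vector_derivative of_real r * (\<i> * cis t) * f1 (z t)) (at t within {a..b})"
      using field_vector_diff_chain_within[OF z, of f _ t "{a..b}", unfolded o_def] f[OF zin[OF t]]
      by (simp add: has_field_derivative_at_within)
    then show "((\<lambda>t. f (\<zeta> + of_real r * cis t)) has_vector_derivative of_real ?\<rho> * cis (\<theta> t)) (at t within {a..b})"
      unfolding e unfolding z_def .
  qed
qed

subsection \<open>Power series with nonnegative coefficients\<close>

definition nonneg_fps :: "complex fps \<Rightarrow> bool" where
  "nonneg_fps F \<longleftrightarrow> (\<forall>n. fps_nth F n \<in> \<real>\<^sub>\<ge>\<^sub>0)"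

lemma nonneg_Reals_sum: "(\<And>i. i \<in> A \<Longrightarrow> f i \<in> \<real>\<^sub>\<ge>\<^sub>0) \<Longrightarrow> sum f A \<in> (\<real>\<^sub>\<ge>\<^sub>0 :: complex set)"
  by (induction A rule: infinite_finite_induct) auto

text \<open>With no constant term in \<open>G\<close>, only coefficients of \<open>F\<close> below
  \<open>n\<close> enter, as the strong inductions below require.\<close>

lemma fps_mult_nth_strict:
  fixes F G :: "'a::comm_ring_1 fps"
  assumes "fps_nth G 0 = 0"
  shows "fps_nth (F * G) n = (\<Sum>i<n. fps_nth F i * fps_nth G (n - i))"
proof -
  have "{0..n} = insert n {..<n}" by auto
  then show ?thesis using assms by (simp add: fps_mult_nth)
qed

text \<open>Comparing coefficients gives 4 (n + \<nu>) q_n = [n = 1] + 4 (sum of q_i q_(n-i) over 0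
  < i < n). For n \<ge> 1 the factor n + \<nu> is positive, so nonnegativity propagates by strong
  induction.\<close>

lemma nonneg_fps_riccati:
  fixes Q :: "complex fps" and \<nu> :: real
  assumes eq: "4 * fps_X * fps_deriv Q - 4 * Q\<^sup>2 = fps_X - fps_const (of_real (4 * \<nu>)) * Q"
    and Q0: "fps_nth Q 0 = 0" and \<nu>: "\<nu> > -1"
  shows "nonneg_fps Q"
  unfolding nonneg_fps_def
proof
  fix n show "fps_nth Q n \<in> \<real>\<^sub>\<ge>\<^sub>0"
  proof (induction n rule: less_induct)
    case (less n)
    show ?case
    proof (cases n)
      case 0 then show ?thesis by (simp add: Q0)
    next
      case (Suc m)
      let ?S = "\<Sum>i\<in>{1..m}. fps_nth Q i * fps_nth Q (n - i)"
      have S: "?S \<in> \<real>\<^sub>\<ge>\<^sub>0"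
        by (intro nonneg_Reals_sum nonneg_Reals_mult_I less) (auto simp: Suc)
      have sq: "fps_nth (Q\<^sup>2) n = ?S"
      proof -
        have "{..<n} = insert 0 {1..m}" using Suc by auto
        then show ?thesis by (simp add: power2_eq_square fps_mult_nth_strict[OF Q0] Q0)
      qed
      have "fps_nth (4 * fps_X * fps_deriv Q - 4 * Q\<^sup>2) n
          = fps_nth (fps_X - fps_const (of_real (4 * \<nu>)) * Q) n" by (simp only: eq)
      then have "4 * (of_nat n * fps_nth Q n) - 4 * ?S
          = (if n = 1 then 1 else 0) - of_real (4 * \<nu>) * fps_nth Q n"
        using sq Suc by (simp add: mult.assoc)
      then have "of_real (4 * (real n + \<nu>)) * fps_nth Q n = (if n = 1 then 1 else 0) + 4 * ?S"
        by (simp add: algebra_simps)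
      moreover have pos: "4 * (real n + \<nu>) > 0" using \<nu> Suc by simp
      ultimately have "fps_nth Q n = ((if n = 1 then 1 else 0) + 4 * ?S) / of_real (4 * (real n + \<nu>))"
        by (simp add: field_simps del: of_real_mult of_real_add)
      moreover have "of_real (4 * (real n + \<nu>)) \<in> (\<real>\<^sub>\<ge>\<^sub>0 :: complex set)" using pos by (simp only: nonneg_Reals_of_real_iff)
      ultimately show ?thesis using S by (simp only:) (intro nonneg_Reals_divide_I nonneg_Reals_add_I; simp)
    qed
  qed
qed

text \<open>A solution of \<open>T = F + T Q\<close> is \<open>F / (1 - Q)\<close>, a geometric series in \<open>Q\<close>.\<close>

lemma nonneg_fps_geometric:
  assumes eq: "T = F + T * Q" and F: "nonneg_fps F" and Q: "nonneg_fps Q" and Q0: "fps_nth Q 0 = 0"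
  shows "nonneg_fps T"
  unfolding nonneg_fps_def
proof
  fix n show "fps_nth T n \<in> \<real>\<^sub>\<ge>\<^sub>0"
  proof (induction n rule: less_induct)
    case (less n)
    have "fps_nth T n = fps_nth F n + fps_nth (T * Q) n" by (metis eq fps_add_nth)
    also have "\<dots> = fps_nth F n + (\<Sum>i<n. fps_nth T i * fps_nth Q (n - i))"
      by (simp add: fps_mult_nth_strict[OF Q0])
    finally show ?case
      using F Q less by (auto simp: nonneg_fps_def intro!: nonneg_Reals_add_I nonneg_Reals_sum nonneg_Reals_mult_I)
  qed
qed

text \<open>Here \<open>F\<close> is \<phi>, \<open>H\<close> is h, \<open>Q\<close> is q,
  \<open>P\<close> is -h''/h', and \<open>T\<close> is z q'/(1 - q), so that z P = Q + T. The
  inverses are legitimate because \<open>F\<close> and \<open>fps_deriv H\<close> have constant term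
  1.\<close>

lemma nonneg_fps_log_deriv:
  fixes F :: "complex fps" and \<nu> :: real
  assumes ode: "4 * fps_X * fps_deriv (fps_deriv F) + fps_const (of_real (4 * (\<nu> + 1))) * fps_deriv F + F = 0"
    and F0: "fps_nth F 0 = 1" and \<nu>: "\<nu> > -1"
  defines "H \<equiv> fps_X * F"
  shows "nonneg_fps (- fps_deriv (fps_deriv H) * inverse (fps_deriv H))"
proof -
  define D D2 where "D = fps_deriv F" and "D2 = fps_deriv (fps_deriv F)"
  have "F \<noteq> 0" using F0 by auto
  define Q where "Q = - (fps_X * D) * inverse F"
  have QF: "Q * F = - (fps_X * D)"
    unfolding Q_def by (simp add: mult.assoc inverse_mult_eq_1 F0)
  have Q0: "fps_nth Q 0 = 0" by (simp add: Q_def)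
  let ?c = "fps_const (of_real \<nu>) :: complex fps"
  have c: "fps_const (of_real (4 * (\<nu> + 1))) = 4 * ?c + 4" "fps_const (of_real (4 * \<nu>)) = 4 * ?c"
    by (simp_all add: fps_eq_iff algebra_simps fps_numeral_nth)
  have ode': "4 * fps_X * D2 = - (4 * ?c + 4) * D - F"
    using ode[unfolded c] by (simp add: D_def D2_def algebra_simps eq_neg_iff_add_eq_0)
  have dQ: "fps_deriv Q * F = - D - fps_X * D2 - Q * D"
    using arg_cong[OF QF, of fps_deriv] by (simp add: D_def D2_def algebra_simps)
  \<comment> \<open>Multiplication by \<open>F\<close> clears the denominators, so that the equation
    follows algebraically from \<open>ode'\<close>, \<open>dQ\<close> and \<open>QF\<close>;
    afterwards \<open>F\<close> cancels as a nonzero series.\<close>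
  have "F * (4 * fps_X * fps_deriv Q - 4 * Q\<^sup>2) = F * (fps_X - fps_const (of_real (4 * \<nu>)) * Q)"
    using ode' dQ QF unfolding c by algebra
  then have ricc: "4 * fps_X * fps_deriv Q - 4 * Q\<^sup>2 = fps_X - fps_const (of_real (4 * \<nu>)) * Q"
    using \<open>F \<noteq> 0\<close> by simp
  have Q: "nonneg_fps Q" by (rule nonneg_fps_riccati[OF ricc Q0 \<nu>])
  have H1: "fps_deriv H = F * (1 - Q)"
    using QF by (simp add: H_def D_def algebra_simps)
  have H2: "fps_deriv (fps_deriv H) = D * (1 - Q) - F * fps_deriv Q"
    by (simp add: H1 D_def algebra_simps)
  define P where "P = - fps_deriv (fps_deriv H) * inverse (fps_deriv H)"
  have "fps_nth (fps_deriv H) 0 = 1" by (simp add: H1 F0 Q0)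
  then have PH: "P * fps_deriv H = - fps_deriv (fps_deriv H)"
    unfolding P_def by (simp add: mult.assoc inverse_mult_eq_1)
  have PF: "P * (F * (1 - Q)) = F * fps_deriv Q - D * (1 - Q)"
    using PH unfolding H2 unfolding H1 by simp
  define T where "T = fps_X * P - Q"
  have "F * (T * (1 - Q)) = F * (fps_X * fps_deriv Q)"
    using PF QF unfolding T_def by algebra
  then have "T * (1 - Q) = fps_X * fps_deriv Q"
    using \<open>F \<noteq> 0\<close> by (metis mult_cancel_left)
  then have T: "T = fps_X * fps_deriv Q + T * Q"
    by (simp add: algebra_simps)
  have XQ: "nonneg_fps (fps_X * fps_deriv Q)"
    unfolding nonneg_fps_def
  proof
    fix n show "fps_nth (fps_X * fps_deriv Q) n \<in> \<real>\<^sub>\<ge>\<^sub>0"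
      using Q by (cases n) (auto simp: nonneg_fps_def simp del: of_nat_Suc)
  qed
  have nT: "nonneg_fps T" by (rule nonneg_fps_geometric[OF T XQ Q Q0])
  \<comment> \<open>The factor \<open>fps_X\<close> in \<open>T + Q = fps_X * P\<close> shifts the
    index by one.\<close>
  have "fps_nth P n = fps_nth T (Suc n) + fps_nth Q (Suc n)" for n by (simp add: T_def)
  then show ?thesis using nT Q unfolding P_def[symmetric] nonneg_fps_def by simp
qed

text \<open>Termwise triangle inequality: nonnegative coefficients equal their moduli, so the sum of
  the moduli is the value at 1. The radius condition provides convergence there.\<close>

lemma norm_eval_nonneg_fps_le:
  assumes P: "nonneg_fps P" and R: "fps_conv_radius P > 1" and z: "norm z \<le> 1"
  shows "norm (eval_fps P z) \<le> Re (eval_fps P 1)"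
proof -
  have 1: "(\<lambda>n. fps_nth P n * 1 ^ n) sums eval_fps P 1"
    by (rule sums_eval_fps) (use R in \<open>simp add: one_ereal_def\<close>)
  have re: "norm (fps_nth P n) = Re (fps_nth P n)" for n
    using P by (auto simp: nonneg_fps_def complex_nonneg_Reals_iff cmod_def)
  have s: "(\<lambda>n. norm (fps_nth P n)) sums Re (eval_fps P 1)"
    using sums_Re[OF 1] by (simp add: re)
  have "ereal (norm z) < fps_conv_radius P" using R z by (meson ereal_less_eq(3) one_ereal_def le_less_trans order.trans ereal_less_eq)
  note zs = sums_eval_fps[OF this] norm_summable_fps[OF this]
  have "norm (eval_fps P z) \<le> (\<Sum>n. norm (fps_nth P n * z ^ n))"
    using summable_norm[OF zs(2)] zs(1) by (simp add: sums_iff)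
  also have "\<dots> \<le> (\<Sum>n. norm (fps_nth P n))"
  proof (rule suminf_le[OF _ zs(2) sums_summable[OF s]])
    fix n have "norm z ^ n \<le> 1" using z by (simp add: power_le_one)
    then show "norm (fps_nth P n * z ^ n) \<le> norm (fps_nth P n)"
      by (simp add: norm_mult norm_power mult_left_le)
  qed
  also have "\<dots> = Re (eval_fps P 1)" using s by (simp add: sums_iff)
  finally show ?thesis .
qed

subsection \<open>The power series of the normalized Bessel function\<close>

text \<open>The Taylor coefficients of \<phi>(z) = h(z)/z, with the quotient of Gamma(n + \<nu> + 1)
  by Gamma(\<nu> + 1) written as a Pochhammer symbol.\<close>

definition bessel_coeff :: "real \<Rightarrow> nat \<Rightarrow> real" where
  "bessel_coeff \<nu> n = (- 1 / 4) ^ n / (fact n * pochhammer (\<nu> + 1) n)"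

definition bessel_fps :: "real \<Rightarrow> complex fps" where
  "bessel_fps \<nu> = Abs_fps (\<lambda>n. of_real (bessel_coeff \<nu> n))"

lemma bessel_coeff_0 [simp]: "bessel_coeff \<nu> 0 = 1"
  by (simp add: bessel_coeff_def)

lemma bessel_coeff_Suc:
  assumes "\<nu> > -1"
  shows "4 * (real n + 1) * (\<nu> + 1 + real n) * bessel_coeff \<nu> (Suc n) = - bessel_coeff \<nu> n"
proof -
  define p q m where "p = pochhammer (\<nu> + 1) n" and "q = \<nu> + 1 + real n" and "m = real n + 1"
  have pos: "p > 0" "q > 0" "m > 0" using assms by (auto intro: pochhammer_pos simp: p_def q_def m_def)
  have c1: "bessel_coeff \<nu> (Suc n) = (- 1 / 4) * (- 1 / 4) ^ n / ((m * fact n) * (p * q))"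
    by (simp add: bessel_coeff_def pochhammer_Suc p_def q_def m_def add_ac)
  have c2: "bessel_coeff \<nu> n = (- 1 / 4) ^ n / (fact n * p)" by (simp add: bessel_coeff_def p_def)
  show ?thesis unfolding q_def[symmetric] m_def[symmetric] c1 c2 using pos by (simp add: field_simps)
qed

text \<open>Every factor of the Pochhammer symbol is at least \<nu> + 1 > 0. The resulting
  exponential majorant controls all later estimates of h' and h''.\<close>

lemma bessel_coeff_abs_le:
  assumes "\<nu> > -1"
  shows "\<bar>bessel_coeff \<nu> n\<bar> \<le> (1 / (4 * (\<nu> + 1))) ^ n / fact n"
proof -
  have "(\<Prod>i\<in>{0..<n}. \<nu> + 1) \<le> (\<Prod>i\<in>{0..<n}. \<nu> + 1 + real i)"
    using assms by (intro prod_mono) auto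
  then have le: "(\<nu> + 1) ^ n \<le> pochhammer (\<nu> + 1) n"
    by (simp add: pochhammer_prod)
  have "(\<nu> + 1) ^ n > 0" using assms by simp
  then have "\<bar>bessel_coeff \<nu> n\<bar> = (1 / 4) ^ n / (fact n * pochhammer (\<nu> + 1) n)"
    using le by (simp add: bessel_coeff_def abs_mult power_abs abs_divide)
  also have "\<dots> \<le> (1 / 4) ^ n / (fact n * (\<nu> + 1) ^ n)"
    using le \<open>(\<nu> + 1) ^ n > 0\<close> by (intro divide_left_mono mult_left_mono mult_pos_pos) auto
  also have "\<dots> = (1 / (4 * (\<nu> + 1))) ^ n / fact n"
  proof -
    have "1 / (4 * (\<nu> + 1)) = 1 / 4 / (\<nu> + 1)" by simp
    then show ?thesis by (simp only: power_divide[of "1 / 4" "\<nu> + 1"]) simp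
  qed
  finally show ?thesis .
qed

lemma bessel_coeff_gamma:
  assumes "\<nu> > -1"
  shows "(- 1) ^ n / (fact n * Gamma (real n + \<nu> + 1)) / 4 ^ n = bessel_coeff \<nu> n / Gamma (\<nu> + 1)"
proof -
  have "\<nu> + 1 \<notin> \<int>\<^sub>\<le>\<^sub>0" using assms by (auto dest: nonpos_Ints_nonpos)
  moreover have g: "Gamma (\<nu> + 1) > 0" using assms by (intro Gamma_real_pos) auto
  ultimately have "Gamma (real n + \<nu> + 1) = pochhammer (\<nu> + 1) n * Gamma (\<nu> + 1)"
    using pochhammer_Gamma[of "\<nu> + 1" n] g by (simp add: algebra_simps)
  moreover have "(- 1 / 4 :: real) ^ n = (- 1) ^ n / 4 ^ n" by (simp only: power_divide)
  ultimately show ?thesis by (simp only: bessel_coeff_def) (simp add: field_simps)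
qed

lemma fps_conv_radius_bessel [simp]:
  assumes "\<nu> > -1"
  shows "fps_conv_radius (bessel_fps \<nu>) = \<infinity>"
proof -
  have "summable (\<lambda>n. fps_nth (bessel_fps \<nu>) n * z ^ n)" for z :: complex
  proof (rule summable_comparison_test')
    let ?x = "1 / (4 * (\<nu> + 1)) * norm z"
    show "summable (\<lambda>n. ?x ^ n / fact n)" using summable_exp[of ?x] by (simp add: field_simps)
    show "norm (fps_nth (bessel_fps \<nu>) n * z ^ n) \<le> ?x ^ n / fact n" for n
    proof -
      have "norm (fps_nth (bessel_fps \<nu>) n * z ^ n) = \<bar>bessel_coeff \<nu> n\<bar> * norm z ^ n"
        by (simp add: bessel_fps_def norm_mult norm_power)
      also have "\<dots> \<le> (1 / (4 * (\<nu> + 1))) ^ n / fact n * norm z ^ n"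
        by (intro mult_right_mono bessel_coeff_abs_le assms) auto
      also have "\<dots> = ?x ^ n / fact n" unfolding power_mult_distrib by simp
      finally show ?thesis .
    qed
  qed
  then show ?thesis unfolding fps_conv_radius_def by (rule conv_radius_inftyI'')
qed

lemma fps_conv_radius_deriv_infinity:
  fixes F :: "complex fps"
  shows "fps_conv_radius F = \<infinity> \<Longrightarrow> fps_conv_radius (fps_deriv F) = \<infinity>"
  using fps_conv_radius_deriv[of F] by (simp add: top_ereal_def)

section \<open>The normalized function as an entire power series, and its differential
  equation\<close>

definition bessel_h_fps :: "real \<Rightarrow> complex fps" where
  "bessel_h_fps \<nu> = fps_X * bessel_fps \<nu>"

lemma bessel_h_fps_conv_radius [simp]:
  assumes "\<nu> > -1"
  shows "fps_conv_radius (bessel_h_fps \<nu>) = \<infinity>"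
    "fps_conv_radius (fps_deriv (bessel_h_fps \<nu>)) = \<infinity>"
    "fps_conv_radius (fps_deriv (fps_deriv (bessel_h_fps \<nu>))) = \<infinity>"
proof -
  show "fps_conv_radius (bessel_h_fps \<nu>) = \<infinity>"
    using fps_conv_radius_mult[of fps_X "bessel_fps \<nu>"] assms by (simp add: bessel_h_fps_def)
  then show "fps_conv_radius (fps_deriv (bessel_h_fps \<nu>)) = \<infinity>"
    "fps_conv_radius (fps_deriv (fps_deriv (bessel_h_fps \<nu>))) = \<infinity>"
    by (simp_all add: fps_conv_radius_deriv_infinity)
qed

lemma bessel_J_eq:
  assumes "\<nu> > -1"
  shows "bessel_J \<nu> z = (if \<nu> = 0 then 1 else (z / 2) powr of_real \<nu>) *
     eval_fps (bessel_fps \<nu>) (z\<^sup>2) / of_real (Gamma (\<nu> + 1))"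
proof -
  have "of_real ((-1) ^ n / (fact n * Gamma (real n + \<nu> + 1))) * (z / 2) ^ (2 * n)
      = fps_nth (bessel_fps \<nu>) n * (z\<^sup>2) ^ n / of_real (Gamma (\<nu> + 1))" for n
  proof -
    have "of_real ((-1) ^ n / (fact n * Gamma (real n + \<nu> + 1))) * (z / 2) ^ (2 * n)
        = of_real ((- 1) ^ n / (fact n * Gamma (real n + \<nu> + 1)) / 4 ^ n) * (z\<^sup>2) ^ n"
      by (simp add: power_mult power_divide)
    also have "\<dots> = fps_nth (bessel_fps \<nu>) n * (z\<^sup>2) ^ n / of_real (Gamma (\<nu> + 1))"
      unfolding bessel_coeff_gamma[OF assms] by (simp add: bessel_fps_def)
    finally show ?thesis .
  qed
  moreover have "(\<lambda>n. fps_nth (bessel_fps \<nu>) n * (z\<^sup>2) ^ n / of_real (Gamma (\<nu> + 1)))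
      sums (eval_fps (bessel_fps \<nu>) (z\<^sup>2) / of_real (Gamma (\<nu> + 1)))"
    by (intro sums_divide sums_eval_fps) (simp add: assms)
  ultimately show ?thesis unfolding bessel_J_def by (simp add: sums_iff)
qed

text \<open>For z \<noteq> 0 the principal powers z^(1 - \<nu>/2) and z^(\<nu>/2) multiply to z, and
  the constants 2^\<nu> and Gamma(\<nu> + 1) cancel. At 0 both sides vanish.\<close>

lemma bessel_h_eq:
  assumes "\<nu> > -1"
  shows "bessel_h \<nu> = eval_fps (bessel_h_fps \<nu>)"
proof
  fix z
  have H: "eval_fps (bessel_h_fps \<nu>) z = z * eval_fps (bessel_fps \<nu>) z"
    unfolding bessel_h_fps_def using assms by (subst eval_fps_mult) auto
  show "bessel_h \<nu> z = eval_fps (bessel_h_fps \<nu>) z"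
  proof (cases "z = 0")
    case True
    then show ?thesis unfolding H by (simp add: bessel_h_def)
  next
    case False
    \<comment> \<open>The imaginary part of \<open>Ln z / 2\<close> lies in (-pi/2, pi/2], where
      \<open>Ln\<close> inverts \<open>exp\<close>; hence no branch correction arises, even on the
      negative axis.\<close>
    have Ln: "Ln (csqrt z / 2) = Ln z / 2 - of_real (ln 2)"
    proof -
      have "csqrt z = exp (Ln z / 2)" using False by (rule csqrt_exp_Ln)
      then have "csqrt z / 2 = exp (Ln z / 2 - of_real (ln 2))"
        by (simp add: exp_diff exp_of_real)
      moreover have "Ln (exp (Ln z / 2 - of_real (ln 2))) = Ln z / 2 - of_real (ln 2)"
        using mpi_less_Im_Ln[OF False] Im_Ln_le_pi[OF False] by (intro Ln_exp) auto
      ultimately show ?thesis by simp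
    qed
    have "(if \<nu> = 0 then 1 else (csqrt z / 2) powr of_real \<nu>) = exp (of_real \<nu> * (Ln z / 2 - of_real (ln 2)))"
      using False by (simp add: powr_def Ln)
    also have "\<dots> = z powr of_real (\<nu> / 2) / of_real (2 powr \<nu>)"
      using False by (simp add: powr_def right_diff_distrib exp_diff exp_of_real[symmetric])
    finally have J: "bessel_J \<nu> (csqrt z) = z powr of_real (\<nu> / 2) / of_real (2 powr \<nu>)
        * eval_fps (bessel_fps \<nu>) z / of_real (Gamma (\<nu> + 1))"
      by (simp add: bessel_J_eq[OF assms])
    have "z powr of_real (1 - \<nu> / 2) * z powr of_real (\<nu> / 2) = z"
      unfolding powr_add[symmetric] using False by (simp flip: of_real_add)
    moreover have "Gamma (\<nu> + 1) > 0" using assms by (intro Gamma_real_pos) auto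
    ultimately show ?thesis unfolding bessel_h_def J H by (simp add: field_simps)
  qed
qed

text \<open>Coefficient \<open>n\<close> of the left-hand side is the two-term recurrence
  \<open>bessel_coeff_Suc\<close>.\<close>

lemma bessel_fps_ode:
  assumes "\<nu> > -1"
  shows "4 * fps_X * fps_deriv (fps_deriv (bessel_fps \<nu>))
    + fps_const (of_real (4 * (\<nu> + 1))) * fps_deriv (bessel_fps \<nu>) + bessel_fps \<nu> = 0"
proof (rule fps_ext)
  fix n
  let ?c = "fps_nth (bessel_fps \<nu>) "
  have "of_real (4 * (real n + 1) * (\<nu> + 1 + real n) * bessel_coeff \<nu> (Suc n)) = - ?c n"
    unfolding bessel_coeff_Suc[OF assms] by (simp add: bessel_fps_def)
  then have "4 * (of_nat n + 1) * (of_real \<nu> + 1 + of_nat n) * ?c (Suc n) + ?c n = 0"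
    by (simp add: bessel_fps_def)
  then show "fps_nth (4 * fps_X * fps_deriv (fps_deriv (bessel_fps \<nu>))
    + fps_const (of_real (4 * (\<nu> + 1))) * fps_deriv (bessel_fps \<nu>) + bessel_fps \<nu>) n = fps_nth 0 n"
    by (cases n) (simp_all add: mult.assoc, simp_all add: algebra_simps)
qed

subsection \<open>Necessity of the boundary condition\<close>

text \<open>For 0 < x < 1 the arc of radius 2x around -x starts at x, and its image starts
  vertically because f'(x) > 0. A nondecreasing tangent angle then forces Re (f'(x) + 2 x f''(x))
  \<ge> 0.\<close>

lemma uniformly_convex_imp_boundary:
  fixes f f1 f2 :: "complex \<Rightarrow> complex"
  assumes f: "\<And>z. (f has_field_derivative f1 z) (at z)"
    and f1: "\<And>z. (f1 has_field_derivative f2 z) (at z)"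
    and cont: "isCont f2 1"
    and real: "\<And>x::real. Im (f1 (of_real x)) = 0"
    and uc: "uniformly_convex f"
  shows "Re (f1 1 + 2 * f2 1) \<ge> 0"
proof -
  have inj: "inj_on f (ball 0 1)" and f10: "f1 0 = 1" and hol: "f holomorphic_on ball 0 1"
    using uc DERIV_imp_deriv[OF f, of 0] by (auto simp: uniformly_convex_def)
  have nz: "f1 z \<noteq> 0" if "z \<in> ball 0 1" for z
    using holomorphic_injective_imp_regular[OF hol _ inj that] DERIV_imp_deriv[OF f, of z] by auto
  have f1c: "continuous_on A f1" for A
    using f1 by (meson DERIV_isCont continuous_at_imp_continuous_on)
  \<comment> \<open>On [0, 1) the derivative is real, zero-free by injectivity, and equal to 1 at 0,
    so a sign change is impossible.\<close>
  have pos: "Re (f1 (of_real x)) > 0" if x: "0 \<le> x" "x < 1" for x :: real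
  proof (rule ccontr)
    assume n: "\<not> Re (f1 (of_real x)) > 0"
    have "continuous_on {0..x} (\<lambda>x. Re (f1 (of_real x)))"
      by (intro continuous_intros continuous_on_compose2[OF f1c[of UNIV]]) auto
    then obtain y where "0 \<le> y" "y \<le> x" "Re (f1 (of_real y)) = 0"
      using IVT2'[of "\<lambda>x. Re (f1 (of_real x))" x 0 0] n f10 x by auto
    then show False using nz[of "of_real y"] real[of y] x by (auto simp: complex_eq_iff)
  qed
  have ineq: "Re (f1 (of_real x) + of_real (2 * x) * f2 (of_real x)) \<ge> 0" if x: "0 < x" "x < 1" for x :: real
  proof -
    define z where "z = (\<lambda>t. - of_real x + of_real (2 * x) * cis t)"
    have z0: "z 0 = of_real x" by (simp add: z_def)
    have z: "(z has_vector_derivative of_real (2 * x) * (\<i> * cis t)) (at t within T)" for t T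
      unfolding z_def by (rule circle_has_vector_derivative)
    have "isCont z 0" using has_vector_derivative_continuous[OF z, of 0 UNIV] by simp
    then have "eventually (\<lambda>t. z t \<in> ball 0 1) (nhds 0)"
      unfolding continuous_at isCont_def tendsto_at_iff_tendsto_nhds
      by (rule topological_tendstoD) (use x in \<open>auto simp: z0\<close>)
    then obtain e where e: "e > 0" "\<And>t. dist t 0 < e \<Longrightarrow> z t \<in> ball 0 1"
      by (auto simp: eventually_nhds_metric)
    define \<delta> where "\<delta> = min (e / 2) 1"
    have \<delta>: "\<delta> > 0" "\<delta> \<le> 1" using e by (auto simp: \<delta>_def)
    have "convex_arc (\<lambda>t. f (- of_real x + of_real (2 * x) * cis t)) 0 \<delta>"
    proof -
      have "- of_real x \<in> ball (0::complex) 1" "2 * x > 0" using x by auto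
      moreover have "0 < \<delta> \<and> \<delta> \<le> 0 + 2 * pi \<and> (\<forall>t\<in>{0..\<delta>}. - of_real x + of_real (2 * x) * cis t \<in> ball 0 1)"
        using \<delta> pi_gt3 e(2) e(1) unfolding z_def by (auto simp: \<delta>_def dist_norm)
      ultimately show ?thesis using uc unfolding uniformly_convex_def by blast
    qed
    then obtain \<theta> where \<theta>: "continuous_on {0..\<delta>} \<theta>" "mono_on {0..\<delta>} \<theta>"
      "\<And>t. t \<in> {0..\<delta>} \<Longrightarrow> \<exists>\<rho>>0. ((\<lambda>t. f (z t)) has_vector_derivative of_real \<rho> * cis (\<theta> t)) (at t within {0..\<delta>})"
      unfolding convex_arc_def z_def by blast
    have ex: "\<exists>\<rho>>0. of_real \<rho> * cis (\<theta> t) = \<i> * (cis t * f1 (z t))" if t: "t \<in> {0..\<delta>}" for t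
    proof -
      obtain \<rho> where \<rho>: "\<rho> > 0"
        "((\<lambda>t. f (z t)) has_vector_derivative of_real \<rho> * cis (\<theta> t)) (at t within {0..\<delta>})"
        using \<theta>(3)[OF t] by blast
      have "((\<lambda>t. f (z t)) has_vector_derivative of_real (2 * x) * (\<i> * cis t) * f1 (z t)) (at t within {0..\<delta>})"
        by (rule field_vector_diff_chain_within[OF z has_field_derivative_at_within[OF f], unfolded o_def])
      then have "of_real \<rho> * cis (\<theta> t) = of_real (2 * x) * (\<i> * cis t) * f1 (z t)"
        using vector_derivative_unique_within_closed_interval[of 0 \<delta> t] \<rho>(2) t \<delta> by (auto simp: cbox_interval)
      then have "of_real (\<rho> / (2 * x)) * cis (\<theta> t) = \<i> * (cis t * f1 (z t))"
        using x by (simp add: field_simps)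
      then show ?thesis using \<rho>(1) x by (intro exI[of _ "\<rho> / (2 * x)"]) auto
    qed
    \<comment> \<open>Up to a positive factor, \<open>k t\<close> is minus the real part of the
      tangent. It vanishes at 0; its right derivative there is the quantity to be estimated.\<close>
    define k where "k = (\<lambda>t. Im (cis t * f1 (z t)))"
    have cis0: "cis (\<theta> 0) = \<i>"
    proof -
      obtain \<rho> where \<rho>: "\<rho> > 0" "of_real \<rho> * cis (\<theta> 0) = \<i> * f1 (of_real x)"
        using ex[of 0] \<delta> z0 by auto
      have e: "f1 (of_real x) = of_real (Re (f1 (of_real x)))" using real[of x] by (simp add: complex_eq_iff)
      have "\<rho> = norm (of_real \<rho> * cis (\<theta> 0))" using \<rho>(1) by (simp add: norm_mult)
      also have "\<dots> = norm (f1 (of_real x))" unfolding \<rho>(2) by (simp add: norm_mult)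
      also have "\<dots> = Re (f1 (of_real x))" using pos[of x] x by (subst e) simp
      finally show ?thesis using \<rho> e by (metis mult.commute mult_cancel_left of_real_eq_0_iff less_irrefl)
    qed
    have ev: "eventually (\<lambda>t. k t \<ge> 0) (at 0 within {0..\<delta>})"
    proof -
      \<comment> \<open>Near 0 the angle has risen by less than pi, where sine is nonnegative. Since
        the initial direction is \<open>\<i>\<close>, that sine is minus the cosine of the current
        angle.\<close>
      have "(\<theta> \<longlongrightarrow> \<theta> 0) (at 0 within {0..\<delta>})" using \<theta>(1) \<delta> by (simp add: continuous_on)
      then have "eventually (\<lambda>t. \<theta> t < \<theta> 0 + pi) (at 0 within {0..\<delta>})"
        by (rule order_tendstoD) (use pi_gt_zero in linarith)
      moreover have "eventually (\<lambda>t. t \<in> {0..\<delta>}) (at 0 within {0..\<delta>})"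
        by (simp add: eventually_at_filter)
      ultimately show ?thesis
      proof eventually_elim
        case (elim t)
        obtain \<rho> where \<rho>: "\<rho> > 0" "of_real \<rho> * cis (\<theta> t) = \<i> * (cis t * f1 (z t))" using ex elim(2) by blast
        have "\<theta> 0 \<le> \<theta> t" using mono_onD[OF \<theta>(2), of 0 t] elim(2) by auto
        then have "sin (\<theta> t - \<theta> 0) \<ge> 0" using elim(1) by (intro sin_ge_zero) auto
        moreover have "sin (\<theta> t - \<theta> 0) = - cos (\<theta> t)"
          using arg_cong[OF cis0, of Re] arg_cong[OF cis0, of Im] by (simp add: sin_diff)
        ultimately have "Re (of_real \<rho> * cis (\<theta> t)) \<le> 0" using \<rho>(1) by (simp add: mult_le_0_iff)
        then show "k t \<ge> 0" unfolding \<rho>(2) k_def by simp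
      qed
    qed
    have k': "(k has_real_derivative Re (f1 (of_real x) + of_real (2 * x) * f2 (of_real x))) (at 0 within {0..\<delta>})"
    proof -
      have c: "(cis has_vector_derivative \<i> * cis 0) (at 0 within {0..\<delta>})"
        using circle_has_vector_derivative[of 0 1 0] by simp
      have "((\<lambda>t. f1 (z t)) has_vector_derivative of_real (2 * x) * (\<i> * cis 0) * f2 (z 0)) (at 0 within {0..\<delta>})"
        by (rule field_vector_diff_chain_within[OF z has_field_derivative_at_within[OF f1], unfolded o_def])
      from has_vector_derivative_mult[OF c this]
      have "((\<lambda>t. cis t * f1 (z t)) has_vector_derivative
          \<i> * (f1 (of_real x) + of_real (2 * x) * f2 (of_real x))) (at 0 within {0..\<delta>})"
        by (simp add: z0 algebra_simps)
      from bounded_linear.has_vector_derivative[OF bounded_linear_Im this]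
      show ?thesis unfolding k_def has_real_derivative_iff_has_vector_derivative by simp
    qed
    have k0: "k 0 = 0" by (simp add: k_def z0 real)
    show ?thesis
    proof (rule ccontr)
      assume "\<not> ?thesis"
      then obtain d where d: "d > 0" "\<And>h. h > 0 \<Longrightarrow> 0 + h \<in> {0..\<delta>} \<Longrightarrow> h < d \<Longrightarrow> k (0 + h) < k 0"
        using has_real_derivative_neg_dec_right[OF k'] by (meson not_le)
      obtain d' where d': "d' > 0" "\<And>t. t \<in> {0..\<delta>} \<Longrightarrow> t \<noteq> 0 \<Longrightarrow> dist t 0 < d' \<Longrightarrow> k t \<ge> 0"
        using ev unfolding eventually_at by blast
      define h where "h = min \<delta> (min (d / 2) (d' / 2))"
      have "h > 0" "h \<le> \<delta>" "h < d" "h < d'" using \<delta> d(1) d'(1) by (auto simp: h_def)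
      then show False using d(2)[of h] d'(2)[of h] k0 by (auto simp: dist_norm)
    qed
  qed
  have "((\<lambda>x. Re (f1 (of_real x) + of_real (2 * x) * f2 (of_real x))) \<longlongrightarrow>
      Re (f1 (of_real 1) + of_real (2 * 1) * f2 (of_real 1))) (at_left 1)"
  proof -
    have l: "((\<lambda>x::real. complex_of_real x) \<longlongrightarrow> 1) (at_left 1)"
      using tendsto_of_real[OF tendsto_ident_at, of 1 "{..<1::real}"] by simp
    have "isCont f1 1" using f1 by (rule DERIV_isCont)
    from isCont_tendsto_compose[OF this l] isCont_tendsto_compose[OF cont l] l show ?thesis
      by (intro tendsto_intros) auto
  qed
  moreover have "eventually (\<lambda>x. Re (f1 (of_real x) + of_real (2 * x) * f2 (of_real x)) \<ge> 0) (at_left (1::real))"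
    by (rule eventually_mono[OF eventually_at_left_real[of 0 "1::real"]]) (use ineq in auto)
  ultimately show ?thesis
    using tendsto_lowerbound[of _ _ "at_left (1::real)"] by force
qed

subsection \<open>Sufficiency of the boundary condition\<close>

text \<open>With x = |z| / (4 (\<nu> + 1)) these series majorize h', and with x = 1 / (4 (\<nu> +
  1)) also h'' on the closed disk. The second reduces to the first by (n + 1)(n + 2)/(n + 1)! = (n +
  2)/n!.\<close>

lemma exp_series_weighted_sums:
  fixes x :: real
  shows "(\<lambda>n. (real n + 1) * (x ^ n / fact n)) sums ((1 + x) * exp x)" (is ?A)
    and "(\<lambda>n. (real n + 1) * (real n + 2) * (x ^ Suc n / fact (Suc n))) sums ((x\<^sup>2 + 2 * x) * exp x)" (is ?B)
proof -
  have e: "(\<lambda>n. x ^ n / fact n) sums exp x" using exp_converges[of x] by (simp add: field_simps)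
  have "(\<lambda>n. x * (x ^ n / fact n)) sums (x * exp x)" by (intro sums_mult e)
  also have "(\<lambda>n. x * (x ^ n / fact n)) = (\<lambda>n. real (Suc n) * (x ^ Suc n / fact (Suc n)))"
    by (simp add: fun_eq_iff field_simps del: of_nat_Suc)
  finally have "(\<lambda>n. real n * (x ^ n / fact n)) sums (x * exp x)"
    using sums_Suc[of "\<lambda>n. real n * (x ^ n / fact n)"] by simp
  from sums_add[OF e this] show A: ?A by (simp only: distrib_right mult_1_left add.commute)
  have "(\<lambda>n. x * ((real n + 1) * (x ^ n / fact n) + x ^ n / fact n)) sums (x * ((1 + x) * exp x + exp x))"
    by (intro sums_mult sums_add A e)
  also have "(\<lambda>n. x * ((real n + 1) * (x ^ n / fact n) + x ^ n / fact n))
      = (\<lambda>n. (real n + 1) * (real n + 2) * (x ^ Suc n / fact (Suc n)))"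
  proof
    fix n
    define t where "t = x ^ n / fact n"
    have "x ^ Suc n / fact (Suc n) = x * t / (real n + 1)" by (simp add: t_def field_simps)
    then show "x * ((real n + 1) * (x ^ n / fact n) + x ^ n / fact n)
        = (real n + 1) * (real n + 2) * (x ^ Suc n / fact (Suc n))"
      unfolding t_def[symmetric] by (simp only: times_divide_eq_right) (simp add: field_simps)
  qed
  finally show ?B by (simp add: algebra_simps power2_eq_square)
qed

lemma norm_eval_fps_le:
  fixes F :: "complex fps"
  assumes "fps_conv_radius F = \<infinity>" "k sums S" and le: "\<And>n. norm (fps_nth F n) * norm z ^ n \<le> k n"
  shows "norm (eval_fps F z) \<le> S"
proof -
  have s: "(\<lambda>n. fps_nth F n * z ^ n) sums eval_fps F z" by (rule sums_eval_fps) (simp add: assms)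
  have "norm (\<Sum>n. fps_nth F n * z ^ n) \<le> (\<Sum>n. k n)"
    by (rule norm_suminf_le) (use assms le in \<open>auto simp: norm_mult norm_power sums_iff\<close>)
  then show ?thesis using s assms(2) by (simp add: sums_iff)
qed

lemma bessel_h_fps_nth:
  "fps_nth (fps_deriv (bessel_h_fps \<nu>)) n = of_real ((real n + 1) * bessel_coeff \<nu> n)"
  "fps_nth (fps_deriv (fps_deriv (bessel_h_fps \<nu>))) n
    = of_real ((real n + 1) * (real n + 2) * bessel_coeff \<nu> (Suc n))"
  by (simp_all add: bessel_h_fps_def bessel_fps_def algebra_simps)

lemma bessel_h_deriv_bound:
  assumes \<nu>: "\<nu> > -1"
  defines "x \<equiv> \<lambda>z. 1 / (4 * (\<nu> + 1)) * norm z"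
  shows "norm (eval_fps (fps_deriv (bessel_h_fps \<nu>)) z - 1) \<le> (1 + x z) * exp (x z) - 1"
proof -
  let ?F = "fps_deriv (bessel_h_fps \<nu>)"
  have "norm (eval_fps (?F - 1) z) \<le> (1 + x z) * exp (x z) - 1"
  proof (rule norm_eval_fps_le)
    show "fps_conv_radius (?F - 1) = \<infinity>"
      using fps_conv_radius_diff[of ?F 1] \<nu> by (simp add: top_ereal_def)
    show "(\<lambda>n. (real n + 1) * (x z ^ n / fact n) - (if n = 0 then 1 else 0)) sums ((1 + x z) * exp (x z) - 1)"
      using sums_single[of 0 "\<lambda>_. 1::real"] by (intro sums_diff exp_series_weighted_sums) simp
    fix n
    show "norm (fps_nth (?F - 1) n) * norm z ^ n \<le> (real n + 1) * (x z ^ n / fact n) - (if n = 0 then 1 else 0)"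
    proof (cases "n = 0")
      case False
      then have "norm (fps_nth (?F - 1) n) * norm z ^ n = (real n + 1) * (\<bar>bessel_coeff \<nu> n\<bar> * norm z ^ n)"
        by (simp only: fps_sub_nth bessel_h_fps_nth fps_one_nth) (simp add: abs_mult del: of_real_add of_real_mult)
      also have "\<dots> \<le> (real n + 1) * ((1 / (4 * (\<nu> + 1))) ^ n / fact n * norm z ^ n)"
        by (intro mult_left_mono mult_right_mono bessel_coeff_abs_le \<nu>) auto
      also have "(1 / (4 * (\<nu> + 1))) ^ n / fact n * norm z ^ n = x z ^ n / fact n"
        unfolding x_def power_mult_distrib by simp
      finally show ?thesis using False by simp
    qed (simp add: bessel_h_fps_def bessel_fps_def)
  qed
  then show ?thesis using \<nu> by (subst (asm) eval_fps_diff) auto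
qed

lemma bessel_h_deriv2_bound:
  assumes \<nu>: "\<nu> > -1" and z: "norm z \<le> 1"
  defines "x \<equiv> 1 / (4 * (\<nu> + 1))"
  shows "norm (eval_fps (fps_deriv (fps_deriv (bessel_h_fps \<nu>))) z) \<le> (x\<^sup>2 + 2 * x) * exp x"
proof (rule norm_eval_fps_le[OF _ exp_series_weighted_sums(2)])
  fix n
  have "norm (fps_nth (fps_deriv (fps_deriv (bessel_h_fps \<nu>))) n) * norm z ^ n
      \<le> (real n + 1) * (real n + 2) * \<bar>bessel_coeff \<nu> (Suc n)\<bar> * 1"
    unfolding bessel_h_fps_nth norm_of_real using z
    by (intro mult_mono) (auto simp: abs_mult power_le_one)
  also have "\<dots> \<le> (real n + 1) * (real n + 2) * (x ^ Suc n / fact (Suc n))"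
    unfolding x_def mult_1_right by (intro mult_left_mono bessel_coeff_abs_le \<nu>) auto
  finally show "norm (fps_nth (fps_deriv (fps_deriv (bessel_h_fps \<nu>))) n) * norm z ^ n
      \<le> (real n + 1) * (real n + 2) * (x ^ Suc n / fact (Suc n))" .
qed (simp add: \<nu>)

lemma Im_eval_fps_eq_0:
  fixes F :: "complex fps"
  assumes "fps_conv_radius F = \<infinity>" "\<And>n. Im (fps_nth F n) = 0"
  shows "Im (eval_fps F (of_real x)) = 0"
proof -
  have "(\<lambda>n. fps_nth F n * of_real x ^ n) sums eval_fps F (of_real x)"
    by (rule sums_eval_fps) (simp add: assms)
  from sums_Im[OF this] show ?thesis by (simp add: assms sums_iff flip: of_real_power)
qed

lemma Im_bessel_h_deriv:
  assumes "\<nu> > -1"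
  shows "Im (eval_fps (fps_deriv (bessel_h_fps \<nu>)) (of_real x)) = 0"
    "Im (eval_fps (fps_deriv (fps_deriv (bessel_h_fps \<nu>))) (of_real x)) = 0"
  by (intro Im_eval_fps_eq_0 bessel_h_fps_conv_radius assms; unfold bessel_h_fps_nth, rule Im_complex_of_real)+

lemma bessel_h_has_derivative:
  assumes "\<nu> > -1"
  shows "(eval_fps (bessel_h_fps \<nu>) has_field_derivative eval_fps (fps_deriv (bessel_h_fps \<nu>)) z) (at z)"
    "(eval_fps (fps_deriv (bessel_h_fps \<nu>)) has_field_derivative
       eval_fps (fps_deriv (fps_deriv (bessel_h_fps \<nu>))) z) (at z)"
  using assms by (auto intro!: has_field_derivative_eval_fps)

text \<open>As h' has no zeros in |z| < R, the series of -h''/h' converges beyond the unit circle;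
  its coefficients are nonnegative, so its modulus is at most its value at 1. Division of the
  boundary condition by h'(1) > 0 bounds that value by 1/2.\<close>

lemma bessel_h_deriv2_le_half:
  assumes \<nu>: "\<nu> > -1" and "R > 1"
    and nz: "\<And>z. norm z < R \<Longrightarrow> eval_fps (fps_deriv (bessel_h_fps \<nu>)) z \<noteq> 0"
    and f11: "Re (eval_fps (fps_deriv (bessel_h_fps \<nu>)) 1) > 0"
    and bd: "Re (eval_fps (fps_deriv (bessel_h_fps \<nu>)) 1
      + 2 * eval_fps (fps_deriv (fps_deriv (bessel_h_fps \<nu>))) 1) \<ge> 0"
    and z: "norm z \<le> 1"
  shows "norm (eval_fps (fps_deriv (fps_deriv (bessel_h_fps \<nu>))) z)
    \<le> norm (eval_fps (fps_deriv (bessel_h_fps \<nu>)) z) / 2"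
proof -
  define F1 F2 where "F1 = fps_deriv (bessel_h_fps \<nu>)" and "F2 = fps_deriv (fps_deriv (bessel_h_fps \<nu>))"
  have r: "fps_conv_radius F1 = \<infinity>" "fps_conv_radius F2 = \<infinity>" using \<nu> by (simp_all add: F1_def F2_def)
  have nz': "ereal (norm z) < ereal R \<Longrightarrow> eval_fps F1 z \<noteq> 0" for z using nz by (simp add: F1_def)
  have inv: "fps_conv_radius (inverse F1) \<ge> R" "norm z < R \<Longrightarrow> eval_fps (inverse F1) z = inverse (eval_fps F1 z)" for z
    using fps_conv_radius_inverse[of "ereal R" F1, OF nz'] eval_fps_inverse[of "ereal R" F1 z, OF nz'] r by auto
  define P where "P = - F2 * inverse F1"
  have P: "eval_fps P z = - (eval_fps F2 z / eval_fps F1 z)" if "norm z < R" for z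
  proof -
    have "ereal (norm z) < fps_conv_radius (inverse F1)"
      using inv(1) that by (meson ereal_less(2) less_ereal.simps(1) order_less_le_trans)
    then have "eval_fps P z = eval_fps (- F2) z * eval_fps (inverse F1) z"
      unfolding P_def by (intro eval_fps_mult) (simp_all add: r)
    also have "eval_fps (- F2) z = - eval_fps F2 z" by (rule eval_fps_minus) (simp add: r)
    finally show ?thesis using inv(2)[OF that] by (simp add: divide_inverse)
  qed
  have "fps_conv_radius P \<ge> ereal R"
    using fps_conv_radius_mult[of "- F2" "inverse F1"] inv(1) r unfolding P_def by simp
  then have rad: "fps_conv_radius P > 1" using \<open>R > 1\<close>
    by (metis ereal_less(2) less_ereal.simps(1) one_ereal_def order_less_le_trans)
  have "nonneg_fps P"
    unfolding P_def F1_def F2_def bessel_h_fps_def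
    by (rule nonneg_fps_log_deriv[OF bessel_fps_ode[OF \<nu>] _ \<nu>]) (simp add: bessel_fps_def)
  from norm_eval_nonneg_fps_le[OF this rad z]
  have le: "norm (eval_fps P z) \<le> Re (eval_fps P 1)" .
  have im: "Im (eval_fps F1 1) = 0" "Im (eval_fps F2 1) = 0"
    using Im_bessel_h_deriv[OF \<nu>, of 1] by (simp_all add: F1_def F2_def)
  have "Re (eval_fps P 1) = - (Re (eval_fps F2 1) / Re (eval_fps F1 1))"
    using P[of 1] \<open>R > 1\<close> im by (simp add: Re_divide power2_eq_square)
  also have "\<dots> \<le> 1 / 2" using f11 bd unfolding F2_def[symmetric] unfolding F1_def[symmetric] by (simp add: field_simps)
  finally have "norm (eval_fps F2 z / eval_fps F1 z) \<le> 1 / 2"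
    using le P[of z] z \<open>R > 1\<close> by simp
  moreover have "eval_fps F1 z \<noteq> 0" using nz[of z] z \<open>R > 1\<close> by (simp add: F1_def)
  ultimately show ?thesis unfolding F2_def[symmetric] unfolding F1_def[symmetric] by (simp add: norm_divide field_simps)
qed

text \<open>The lower bound on \<nu> makes explicit estimates available: Re h' > 0 for |z| < 3/2,
  and |h''| \<le> M \<le> |h'| on the closed disk, which give injectivity and convexity of the
  image. The boundary condition enters through the arcs alone.\<close>

lemma bessel_h_uniformly_convexI:
  assumes \<nu>: "\<nu> \<ge> 306 / 1000"
    and bd: "Re (eval_fps (fps_deriv (bessel_h_fps \<nu>)) 1
      + 2 * eval_fps (fps_deriv (fps_deriv (bessel_h_fps \<nu>))) 1) \<ge> 0"
  shows "uniformly_convex (bessel_h \<nu>)"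
proof -
  have \<nu>1: "\<nu> > -1" using \<nu> by simp
  define f f1 f2 where "f = eval_fps (bessel_h_fps \<nu>)" and "f1 = eval_fps (fps_deriv (bessel_h_fps \<nu>))"
    and "f2 = eval_fps (fps_deriv (fps_deriv (bessel_h_fps \<nu>)))"
  have f: "(f has_field_derivative f1 z) (at z)" and f1: "(f1 has_field_derivative f2 z) (at z)" for z
    unfolding f_def f1_def f2_def by (rule bessel_h_has_derivative[OF \<nu>1])+
  define y where "y = 1 / (4 * (\<nu> + 1))"
  \<comment> \<open>1 / (4 * 1.306) is just below 0.1915. The constant 0.28725 below is 3/2 times
    0.1915.\<close>
  have y: "0 \<le> y" "y \<le> 1915 / 10000" using \<nu> by (auto simp: y_def field_simps)
  have near1: "norm (f1 z - 1) < 1" if z: "norm z < 3 / 2" for z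
  proof -
    have x: "0 \<le> y * norm z" "y * norm z \<le> 28725 / 100000"
      using y mult_mono[of y "1915 / 10000" "norm z" "3 / 2"] z by auto
    have "(1 + y * norm z) * exp (y * norm z) \<le> (1 + 28725 / 100000) * (1 + 28725 / 100000 + (28725 / 100000)\<^sup>2)"
    proof (intro mult_mono)
      have "exp (y * norm z) \<le> 1 + y * norm z + (y * norm z)\<^sup>2" using x by (intro exp_bound) auto
      also have "\<dots> \<le> 1 + 28725 / 100000 + (28725 / 100000)\<^sup>2" using x by (intro add_mono power_mono) auto
      finally show "exp (y * norm z) \<le> \<dots>" .
    qed (use x in auto)
    also have "\<dots> < 2" by (simp add: power2_eq_square)
    finally show ?thesis using bessel_h_deriv_bound[OF \<nu>1, of z] unfolding f1_def y_def by simp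
  qed
  have re: "Re (f1 z) > 0" if "norm z < 3 / 2" for z
    using near1[OF that] abs_Re_le_cmod[of "f1 z - 1"] by simp
  have half: "norm (f2 z) \<le> norm (f1 z) / 2" if "norm z \<le> 1" for z
    unfolding f1_def f2_def
  proof (rule bessel_h_deriv2_le_half[OF \<nu>1 _ _ _ bd that, of "3 / 2"])
    fix z :: complex assume "norm z < 3 / 2"
    then show "eval_fps (fps_deriv (bessel_h_fps \<nu>)) z \<noteq> 0" using re[of z] by (auto simp: f1_def)
  qed (use re[of 1] in \<open>auto simp: f1_def\<close>)
  define M where "M = (y\<^sup>2 + 2 * y) * exp y"
  have M: "M > 0" using \<nu> unfolding M_def y_def by (simp add: add_pos_pos)
  have f2M: "norm (f2 z) \<le> M" if "norm z \<le> 1" for z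
    using bessel_h_deriv2_bound[OF \<nu>1 that] by (simp add: f2_def M_def y_def)
  have f1M: "M \<le> norm (f1 z)" if z: "norm z \<le> 1" for z
  proof -
    \<comment> \<open>The claim \<open>M \<le> 2 - (1 + y) * exp y\<close> is equivalent to
      \<open>(1 + 3 * y + y^2) * exp y \<le> 2\<close>; its right-hand side bounds |h'| from
      below.\<close>
    have "(1 + 3 * y + y\<^sup>2) * exp y \<le> (1 + 3 * (1915 / 10000) + (1915 / 10000)\<^sup>2) * (1 + 1915 / 10000 + (1915 / 10000)\<^sup>2)"
    proof (intro mult_mono)
      have "exp y \<le> 1 + y + y\<^sup>2" using y by (intro exp_bound) auto
      also have "\<dots> \<le> 1 + 1915 / 10000 + (1915 / 10000)\<^sup>2" using y by (intro add_mono power_mono) auto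
      finally show "exp y \<le> \<dots>" .
    qed (use y in \<open>auto intro!: add_mono power_mono\<close>)
    also have "\<dots> \<le> 2" by (simp add: power2_eq_square)
    finally have *: "M \<le> 2 - (1 + y) * exp y" by (simp add: M_def algebra_simps)
    have "norm (f1 z - 1) \<le> (1 + y * norm z) * exp (y * norm z) - 1"
      using bessel_h_deriv_bound[OF \<nu>1, of z] unfolding f1_def y_def .
    also have "\<dots> \<le> (1 + y) * exp y - 1"
      using y z by (intro diff_mono mult_mono) (auto simp: mult_left_le)
    finally show ?thesis using * norm_triangle_ineq2[of 1 "1 - f1 z"] by (simp add: norm_minus_commute)
  qed
  \<comment> \<open>The Noshiro-Warschawski argument: if f(w) = f(z), the mean value theorem for
    f/(z - w) on the segment yields a point with Re f' = 0.\<close>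
  have inj: "inj_on f (ball 0 1)"
  proof (rule inj_onI, rule ccontr)
    fix w z assume wz: "w \<in> ball 0 1" "z \<in> ball 0 1" "f w = f z" "w \<noteq> z"
    have d: "((\<lambda>u. f u / (z - w)) has_field_derivative f1 u / (z - w)) (at u)" for u
      by (intro DERIV_cdivide f)
    obtain u where u: "u \<in> closed_segment w z"
      "Re (f z / (z - w)) - Re (f w / (z - w)) = Re (f1 u / (z - w) * (z - w))"
      using complex_mvt_line[of w z "\<lambda>u. f u / (z - w)" "\<lambda>u. f1 u / (z - w)"] d by blast
    have "u \<in> ball 0 1" using u(1) wz convex_ball[of "0::complex" 1] by (meson closed_segment_subset subsetD)
    then show False using u(2) wz re[of u] by simp
  qed
  have "f holomorphic_on ball 0 1"
    using f by (meson has_field_derivative_at_within holomorphic_onI field_differentiable_def)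
  moreover have "f 0 = 0" by (simp add: f_def eval_fps_at_0 bessel_h_fps_def)
  moreover have "deriv f 0 = 1"
    using DERIV_imp_deriv[OF f, of 0] by (simp add: f1_def eval_fps_at_0 bessel_h_fps_def bessel_fps_def)
  moreover have "convex (f ` ball 0 1)"
    by (rule convex_image_unit_disk[OF f f1 inj M f2M f1M])
  moreover have "convex_arc (\<lambda>t. f (\<zeta> + of_real r * cis t)) a b"
    if "\<zeta> \<in> ball 0 1" "r > 0" "\<forall>t\<in>{a..b}. \<zeta> + of_real r * cis t \<in> ball 0 1" for \<zeta> r a b
    by (rule convex_arc_circle[of f f1 f2]) (use f f1 re half that in auto)
  ultimately show ?thesis
    using inj unfolding bessel_h_eq[OF \<nu>1] f_def[symmetric] uniformly_convex_def by blast
qed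

subsection \<open>The sign of the boundary value\<close>

definition bessel_discr :: "real \<Rightarrow> complex" where
  "bessel_discr \<nu> = eval_fps (fps_deriv (bessel_h_fps \<nu>)) 1
     + 2 * eval_fps (fps_deriv (fps_deriv (bessel_h_fps \<nu>))) 1"

text \<open>The weight is n + 1 from h' plus 2 n (n + 1) from 2 h''; the latter vanishes at n = 0,
  which permits the index shift.\<close>

lemma bessel_discr_sums:
  assumes \<nu>: "\<nu> > -1"
  shows "(\<lambda>n. (real n + 1) * (2 * real n + 1) * bessel_coeff \<nu> n) sums Re (bessel_discr \<nu>)"
proof -
  have 1: "(\<lambda>n. fps_nth (fps_deriv (bessel_h_fps \<nu>)) n * 1 ^ n) sums eval_fps (fps_deriv (bessel_h_fps \<nu>)) 1"
    and 2: "(\<lambda>n. fps_nth (fps_deriv (fps_deriv (bessel_h_fps \<nu>))) n * 1 ^ n) sums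
      eval_fps (fps_deriv (fps_deriv (bessel_h_fps \<nu>))) 1"
    using \<nu> by (simp_all only: sums_eval_fps bessel_h_fps_conv_radius less_ereal.simps)
  have 1: "(\<lambda>n. (real n + 1) * bessel_coeff \<nu> n) sums Re (eval_fps (fps_deriv (bessel_h_fps \<nu>)) 1)"
    using sums_Re[OF 1] by (simp only: bessel_h_fps_nth power_one mult_1_right Re_complex_of_real)
  have "(\<lambda>n. (real n + 1) * (real n + 2) * bessel_coeff \<nu> (Suc n)) sums
      Re (eval_fps (fps_deriv (fps_deriv (bessel_h_fps \<nu>))) 1)"
    using sums_Re[OF 2] by (simp only: bessel_h_fps_nth power_one mult_1_right Re_complex_of_real)
  then have "(\<lambda>n. real (Suc n) * (real (Suc n) + 1) * bessel_coeff \<nu> (Suc n)) sums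
      Re (eval_fps (fps_deriv (fps_deriv (bessel_h_fps \<nu>))) 1)"
    by (simp add: add_ac)
  then have 2: "(\<lambda>n. real n * (real n + 1) * bessel_coeff \<nu> n) sums
      Re (eval_fps (fps_deriv (fps_deriv (bessel_h_fps \<nu>))) 1)"
    by (subst (asm) sums_Suc_iff) simp
  from sums_add[OF 1 sums_mult[OF 2, of 2]] show ?thesis
    by (simp add: bessel_discr_def algebra_simps)
qed

lemma Im_bessel_discr:
  assumes "\<nu> > -1"
  shows "Im (bessel_discr \<nu>) = 0"
  using Im_bessel_h_deriv[OF assms, of 1] by (simp add: bessel_discr_def)

text \<open>
  Multiplied by \<open>\<nu> + 1\<close>, the discriminant loses its pole at \<open>-1\<close> and becomes
  \<open>\<nu> - 1/2\<close> plus a perturbation that is Lipschitz with constant below \<open>1\<close>.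
\<close>

definition pert_term :: "real \<Rightarrow> nat \<Rightarrow> real" where
  "pert_term \<nu> m = (- 1 / 4) ^ (m + 2) * ((real m + 3) * (2 * real m + 5)) / fact (m + 2)
     * inverse (pochhammer (\<nu> + 2) (m + 1))"

definition pert :: "real \<Rightarrow> real" where
  "pert \<nu> = (\<Sum>m. pert_term \<nu> m)"

text \<open>After multiplication by \<nu> + 1 the terms n = 0 and n = 1 give \<nu> + 1 and -3/2. In
  all later terms \<nu> + 1 cancels the first Pochhammer factor; they form \<open>pert\<close>, with
  the index shifted by 2.\<close>

lemma bessel_discr_eq:
  assumes \<nu>: "\<nu> > -1"
  shows "pert_term \<nu> sums pert \<nu>" "(\<nu> + 1) * Re (bessel_discr \<nu>) = \<nu> - 1 / 2 + pert \<nu>"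
proof -
  let ?t = "\<lambda>n. (\<nu> + 1) * ((real n + 1) * (2 * real n + 1) * bessel_coeff \<nu> n)"
  have "?t sums ((\<nu> + 1) * Re (bessel_discr \<nu>))" by (intro sums_mult bessel_discr_sums \<nu>)
  then have "(\<lambda>m. ?t (m + 2)) sums ((\<nu> + 1) * Re (bessel_discr \<nu>) - (\<Sum>i<2. ?t i))"
    by (rule sums_split_initial_segment)
  moreover have "?t (m + 2) = pert_term \<nu> m" for m
  proof -
    have "pochhammer (\<nu> + 1) (m + 2) = (\<nu> + 1) * pochhammer (\<nu> + 2) (m + 1)"
      using pochhammer_rec[of "\<nu> + 1" "m + 1"] by (simp add: add_ac)
    then have "bessel_coeff \<nu> (m + 2) = (- 1 / 4) ^ (m + 2) / fact (m + 2) / (\<nu> + 1) * inverse (pochhammer (\<nu> + 2) (m + 1))"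
      unfolding bessel_coeff_def by (simp only: divide_inverse inverse_mult_distrib mult_ac)
    then show ?thesis using \<nu> unfolding pert_term_def by (simp add: add_ac del: fact_Suc pochhammer_Suc power_Suc)
  qed
  moreover have "(\<Sum>i<2. ?t i) = \<nu> - 1 / 2"
  proof -
    have "(\<nu> + 1) * bessel_coeff \<nu> 1 = - 1 / 4"
      using \<nu> by (simp add: bessel_coeff_def)
    then show ?thesis by (simp add: numeral_2_eq_2)
  qed
  ultimately have s: "pert_term \<nu> sums ((\<nu> + 1) * Re (bessel_discr \<nu>) - (\<nu> - 1 / 2))" by simp
  then show "pert_term \<nu> sums pert \<nu>" "(\<nu> + 1) * Re (bessel_discr \<nu>) = \<nu> - 1 / 2 + pert \<nu>"
    unfolding pert_def by (auto simp: sums_iff)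
qed

section \<open>Lipschitz bound for the perturbation\<close>

text \<open>Equality holds at m = 0, and the ratio \<open>q\<close> of consecutive terms is at most
  1/3. The factor m + 1 anticipates the Lipschitz constant of a reciprocal Pochhammer symbol with m
  + 1 factors.\<close>

lemma pert_coeff_bound:
  "((1 / 4) ^ (m + 2) * ((real m + 3) * (2 * real m + 5)) / fact (m + 2)) * (real m + 1) \<le> 15 / 32 * (1 / 3) ^ m"
  (is "?e m * _ \<le> _")
proof (induction m)
  case (Suc m)
  have pos: "(real m + 3) * (2 * real m + 5) * (real m + 1) > 0" by simp
  define q where "q = (real m + 4) * (2 * real m + 7) * (real m + 2) / (4 * (real m + 3) * ((real m + 3) * (2 * real m + 5) * (real m + 1)))"
  have "?e (Suc m) * (real (Suc m) + 1) = ?e m * (real m + 1) * q"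
  proof -
    define A B s where "A = (1 / 4 :: real) ^ (m + 2)" and "B = (fact (m + 2) :: real)" and "s = real m"
    have "B > 0" "s \<ge> 0" by (simp_all add: B_def s_def)
    have "(1 / 4 :: real) ^ (Suc m + 2) = A / 4" "(fact (Suc m + 2) :: real) = (s + 3) * B" "real (Suc m) = s + 1"
      by (simp_all add: A_def B_def s_def algebra_simps)
    moreover have "(A / 4 * ((s + 4) * (2 * s + 7)) / ((s + 3) * B)) * (s + 2)
        = (A * ((s + 3) * (2 * s + 5)) / B) * (s + 1) *
          ((s + 4) * (2 * s + 7) * (s + 2) / (4 * (s + 3) * ((s + 3) * (2 * s + 5) * (s + 1))))"
    proof -
      have "s + 3 \<noteq> 0" "2 * s + 5 \<noteq> 0" "s + 1 \<noteq> 0" "B \<noteq> 0" using \<open>B > 0\<close> \<open>s \<ge> 0\<close> by auto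
      then show ?thesis by (simp add: divide_simps)
    qed
    ultimately show ?thesis
      unfolding q_def A_def[symmetric] B_def[symmetric] s_def[symmetric] by (simp add: add_ac)
  qed
  also have "q \<le> 1 / 3"
  proof -
    have "3 * ((real m + 4) * (2 * real m + 7) * (real m + 2)) \<le> 4 * (real m + 3) * ((real m + 3) * (2 * real m + 5) * (real m + 1))"
      by (simp add: algebra_simps)
    then show ?thesis unfolding q_def using pos by (simp add: divide_le_eq)
  qed
  then have "?e m * (real m + 1) * q \<le> ?e m * (real m + 1) * (1 / 3)"
    by (intro mult_left_mono) auto
  also have "\<dots> \<le> 15 / 32 * (1 / 3) ^ m * (1 / 3)" using Suc by (intro mult_right_mono) auto
  finally show ?case by simp
qed (simp add: fact_numeral power2_eq_square)

text \<open>Each reciprocal factor lies in (0, 1] and is 1-Lipschitz in the order, so the product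
  rule adds one to the constant per factor.\<close>

lemma inverse_pochhammer_bounds:
  fixes \<mu> \<nu> :: real
  assumes "\<mu> > -1" "\<nu> > -1"
  shows "0 < inverse (pochhammer (\<nu> + 2) k)" "inverse (pochhammer (\<nu> + 2) k) \<le> 1"
    and "\<bar>inverse (pochhammer (\<mu> + 2) k) - inverse (pochhammer (\<nu> + 2) k)\<bar> \<le> real k * \<bar>\<mu> - \<nu>\<bar>"
proof -
  have b: "0 < inverse (pochhammer (x + 2) k) \<and> inverse (pochhammer (x + 2) k) \<le> 1" if "x > -1" for x :: real and k
  proof (induction k)
    case (Suc k)
    have "0 < inverse (x + 2 + real k)" "inverse (x + 2 + real k) \<le> 1"
      using that by (auto simp: inverse_le_1_iff)
    then show ?case using Suc by (auto simp: pochhammer_Suc intro!: mult_le_one)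
  qed simp
  then show "0 < inverse (pochhammer (\<nu> + 2) k)" "inverse (pochhammer (\<nu> + 2) k) \<le> 1" using assms by auto
  show "\<bar>inverse (pochhammer (\<mu> + 2) k) - inverse (pochhammer (\<nu> + 2) k)\<bar> \<le> real k * \<bar>\<mu> - \<nu>\<bar>"
  proof (induction k)
    case (Suc k)
    define a b where "a = inverse (pochhammer (\<mu> + 2) k)" and "b = inverse (pochhammer (\<nu> + 2) k)"
    define c d where "c = inverse (\<mu> + 2 + real k)" and "d = inverse (\<nu> + 2 + real k)"
    have cd: "0 < c" "c \<le> 1" "0 < d" "d \<le> 1"
      using assms by (auto simp: c_def d_def inverse_le_1_iff)
    have "c - d = c * d * (\<nu> - \<mu>)" using assms by (simp add: c_def d_def field_simps)
    then have "\<bar>c - d\<bar> = c * d * \<bar>\<mu> - \<nu>\<bar>" using cd by (simp add: abs_mult)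
    also have "\<dots> \<le> 1 * \<bar>\<mu> - \<nu>\<bar>" using cd by (intro mult_right_mono mult_le_one) auto
    finally have 1: "\<bar>c - d\<bar> \<le> \<bar>\<mu> - \<nu>\<bar>" by simp
    have "\<bar>a * c - b * d\<bar> = \<bar>(a - b) * c + b * (c - d)\<bar>" by (simp add: algebra_simps)
    also have "\<dots> \<le> \<bar>a - b\<bar> * c + b * \<bar>c - d\<bar>"
      using cd b[OF assms(2), of k] by (intro order.trans[OF abs_triangle_ineq]) (simp add: abs_mult b_def)
    also have "\<dots> \<le> \<bar>a - b\<bar> * 1 + 1 * \<bar>\<mu> - \<nu>\<bar>"
      using cd b[OF assms(2), of k] 1 by (intro add_mono mult_mono) (auto simp: b_def)
    also have "\<dots> \<le> real (Suc k) * \<bar>\<mu> - \<nu>\<bar>" using Suc by (simp add: a_def b_def algebra_simps)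
    finally show ?case by (simp add: pochhammer_Suc a_def b_def c_def d_def)
  qed simp
qed

text \<open>Summing the geometric majorant gives 15/32 * 3/2 = 45/64. That this is below 1 makes
  \<nu> - 1/2 + pert(\<nu>) strictly increasing.\<close>

lemma pert_lipschitz:
  assumes "\<mu> > -1" "\<nu> > -1"
  shows "\<bar>pert \<mu> - pert \<nu>\<bar> \<le> 45 / 64 * \<bar>\<mu> - \<nu>\<bar>"
proof -
  have s: "(\<lambda>m. pert_term \<mu> m - pert_term \<nu> m) sums (pert \<mu> - pert \<nu>)"
    by (intro sums_diff bessel_discr_eq assms)
  have g: "(\<lambda>m. 15 / 32 * \<bar>\<mu> - \<nu>\<bar> * (1 / 3) ^ m) sums (15 / 32 * \<bar>\<mu> - \<nu>\<bar> * (1 / (1 - 1 / 3)))"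
    by (intro sums_mult geometric_sums) simp
  have le: "norm (pert_term \<mu> m - pert_term \<nu> m) \<le> 15 / 32 * \<bar>\<mu> - \<nu>\<bar> * (1 / 3) ^ m" for m
  proof -
    let ?e = "(1 / 4) ^ (m + 2) * ((real m + 3) * (2 * real m + 5)) / fact (m + 2)"
    let ?i = "\<lambda>x. inverse (pochhammer (x + 2) (m + 1))"
    have "norm (pert_term \<mu> m - pert_term \<nu> m) = ?e * \<bar>?i \<mu> - ?i \<nu>\<bar>"
      unfolding pert_term_def right_diff_distrib[symmetric]
      by (simp add: abs_mult power_abs del: power_Suc fact_Suc pochhammer_Suc)
    also have "\<dots> \<le> ?e * (real (m + 1) * \<bar>\<mu> - \<nu>\<bar>)"
      by (intro mult_left_mono inverse_pochhammer_bounds assms) auto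
    also have "\<dots> = ?e * (real m + 1) * \<bar>\<mu> - \<nu>\<bar>"
      by (simp only: of_nat_add of_nat_1 mult.assoc)
    also have "\<dots> \<le> 15 / 32 * (1 / 3) ^ m * \<bar>\<mu> - \<nu>\<bar>"
      by (intro mult_right_mono pert_coeff_bound) auto
    finally show ?thesis by (simp add: mult_ac)
  qed
  have "norm (\<Sum>m. pert_term \<mu> m - pert_term \<nu> m) \<le> (\<Sum>m. 15 / 32 * \<bar>\<mu> - \<nu>\<bar> * (1 / 3) ^ m)"
    by (rule norm_suminf_le) (use g le in \<open>auto simp: sums_iff\<close>)
  then show ?thesis using s g by (simp add: sums_iff)
qed

section \<open>Location of the root\<close>

text \<open>For \<nu> \<ge> 0 the Pochhammer symbol is at least 2^(m + 1), which improves the ratio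
  1/3 to 1/6. The tail after eight terms is below 1.7 * 10^(-7).\<close>

lemma pert_approx:
  assumes "\<nu> \<ge> 0"
  shows "\<bar>pert \<nu> - (\<Sum>m<8. pert_term \<nu> m)\<bar> \<le> 15 / 64 * (1 / 6) ^ 8 * (6 / 5)"
proof -
  have s: "(\<lambda>m. pert_term \<nu> (m + 8)) sums (pert \<nu> - (\<Sum>m<8. pert_term \<nu> m))"
    by (intro sums_split_initial_segment bessel_discr_eq) (use assms in simp)
  have g: "(\<lambda>m. 15 / 64 * (1 / 6) ^ 8 * (1 / 6) ^ m) sums (15 / 64 * (1 / 6) ^ 8 * (1 / (1 - 1 / 6)) :: real)"
    by (intro sums_mult geometric_sums) simp
  have le: "norm (pert_term \<nu> m) \<le> 15 / 64 * (1 / 6) ^ m" for m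
  proof -
    let ?e = "(1 / 4) ^ (m + 2) * ((real m + 3) * (2 * real m + 5)) / fact (m + 2)"
    have "(\<Prod>i\<in>{0..<m + 1}. 2) \<le> (\<Prod>i\<in>{0..<m + 1}. \<nu> + 2 + real i)"
      using assms by (intro prod_mono) auto
    then have p: "2 ^ (m + 1) \<le> pochhammer (\<nu> + 2) (m + 1)" by (simp only: pochhammer_prod) simp
    then have "inverse (pochhammer (\<nu> + 2) (m + 1)) \<le> inverse (2 ^ (m + 1))"
      by (intro le_imp_inverse_le) auto
    moreover have "?e \<le> 15 / 32 * (1 / 3) ^ m"
    proof -
      have "?e * 1 \<le> ?e * (real m + 1)" by (intro mult_left_mono) auto
      then show ?thesis using pert_coeff_bound[of m] by linarith
    qed
    moreover have "0 < pochhammer (\<nu> + 2) (m + 1)" using assms by (intro pochhammer_pos) auto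
    ultimately have "?e * inverse (pochhammer (\<nu> + 2) (m + 1)) \<le> (15 / 32 * (1 / 3) ^ m) * inverse (2 ^ (m + 1))"
      by (intro mult_mono) (auto simp del: pochhammer_Suc fact_Suc power_Suc)
    also have "\<dots> = 15 / 64 * ((1 / 3) ^ m * (1 / 2) ^ m)" by (simp add: power_divide field_simps)
    also have "(1 / 3) ^ m * (1 / 2) ^ m = (1 / 6 :: real) ^ m" by (simp flip: power_mult_distrib)
    finally show ?thesis using \<open>0 < pochhammer (\<nu> + 2) (m + 1)\<close> unfolding pert_term_def
      by (simp add: abs_mult power_abs del: power_Suc fact_Suc pochhammer_Suc)
  qed
  have "norm (\<Sum>m. pert_term \<nu> (m + 8)) \<le> (\<Sum>m. 15 / 64 * (1 / 6) ^ 8 * (1 / 6) ^ m)"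
  proof (rule norm_suminf_le)
    show "norm (pert_term \<nu> (m + 8)) \<le> 15 / 64 * (1 / 6) ^ 8 * (1 / 6) ^ m" for m
      using le[of "m + 8"] by (simp add: power_add mult_ac)
  qed (use g in \<open>simp add: sums_iff\<close>)
  then show ?thesis using s g by (simp add: sums_iff)
qed

text \<open>At 0.30608 - 0.000005 and 0.30608 + 0.000005 the eight leading terms are rational and
  evaluated exactly; their sum leaves room for the tail bound.\<close>

lemma pert_at_endpoints:
  "306075 / 1000000 - 1 / 2 + pert (306075 / 1000000) < 0"
  "306085 / 1000000 - 1 / 2 + pert (306085 / 1000000) > 0"
proof -
  have "306075 / 1000000 - 1 / 2 + (\<Sum>m<8. pert_term (306075 / 1000000) m) + 15 / 64 * (1 / 6) ^ 8 * (6 / 5) < 0"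
    by (simp add: pert_term_def numeral_eq_Suc pochhammer_Suc)
  then show "306075 / 1000000 - 1 / 2 + pert (306075 / 1000000) < 0"
    using pert_approx[of "306075 / 1000000"] by linarith
  have "306085 / 1000000 - 1 / 2 + (\<Sum>m<8. pert_term (306085 / 1000000) m) - 15 / 64 * (1 / 6) ^ 8 * (6 / 5) > 0"
    by (simp add: pert_term_def numeral_eq_Suc pochhammer_Suc)
  then show "306085 / 1000000 - 1 / 2 + pert (306085 / 1000000) > 0"
    using pert_approx[of "306085 / 1000000"] by linarith
qed

text \<open>The intermediate value theorem gives a zero of \<open>g\<close> between the endpoints,
  and strict monotonicity on (-1, \<infinity>) determines the sign everywhere else.\<close>

lemma bessel_discr_root:
  obtains \<nu>\<^sub>3 where "306075 / 1000000 < \<nu>\<^sub>3" "\<nu>\<^sub>3 < 306085 / 1000000"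
    "\<And>\<nu>. \<nu> > -1 \<Longrightarrow> sgn (Re (bessel_discr \<nu>)) = sgn (\<nu> - \<nu>\<^sub>3)"
proof -
  define g where "g = (\<lambda>\<nu>. \<nu> - 1 / 2 + pert \<nu>)"
  have incr: "g \<mu> < g \<nu>" if "\<mu> > -1" "\<mu> < \<nu>" for \<mu> \<nu>
  proof -
    have "pert \<mu> - pert \<nu> \<le> \<bar>pert \<mu> - pert \<nu>\<bar>" by simp
    also have "\<dots> \<le> 45 / 64 * \<bar>\<mu> - \<nu>\<bar>" using that by (intro pert_lipschitz) auto
    also have "\<dots> < \<nu> - \<mu>" using that(2) by simp
    finally show ?thesis unfolding g_def by simp
  qed
  have "(45 / 64)-lipschitz_on {-1<..} pert"
    by (rule lipschitz_onI) (unfold dist_real_def, rule pert_lipschitz, auto)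
  then have "continuous_on {-1<..} pert" by (rule lipschitz_on_continuous_on)
  then have "continuous_on {306075 / 1000000..306085 / 1000000} g"
    unfolding g_def by (intro continuous_intros) (auto elim: continuous_on_subset)
  then obtain r where r: "306075 / 1000000 \<le> r" "r \<le> 306085 / 1000000" "g r = 0"
    using IVT'[of g "306075 / 1000000" 0 "306085 / 1000000"] pert_at_endpoints by (auto simp: g_def)
  have "r \<noteq> 306075 / 1000000" "r \<noteq> 306085 / 1000000"
    using pert_at_endpoints r(3) unfolding g_def by (metis less_irrefl)+
  moreover have "sgn (Re (bessel_discr \<nu>)) = sgn (\<nu> - r)" if \<nu>: "\<nu> > -1" for \<nu>
  proof -
    have "sgn ((\<nu> + 1) * Re (bessel_discr \<nu>)) = sgn (g \<nu>)"
      unfolding bessel_discr_eq(2)[OF \<nu>] g_def ..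
    then have "sgn (Re (bessel_discr \<nu>)) = sgn (g \<nu>)" using \<nu> by (simp add: sgn_mult)
    also have "\<dots> = sgn (\<nu> - r)"
      using incr[of \<nu> r] incr[of r \<nu>] \<nu> r by (cases \<nu> r rule: linorder_cases) (auto simp: sgn_if)
    finally show ?thesis .
  qed
  ultimately show ?thesis using r that[of r] by force
qed

section \<open>The boundary value in terms of Bessel functions at 1\<close>

text \<open>The values of J at orders \<mu> and \<mu> + 1 are multiples of the moments
  \<open>S\<close> and \<open>T\<close> of the coefficients. The Bessel recurrence eliminates the
  second moment from the discriminant.\<close>

lemma bessel_J_discr:
  assumes "\<mu> \<ge> 0"
  shows "of_real (2 * \<mu> - 3) * bessel_J (\<mu> + 1) 1 + bessel_J \<mu> 1
    = of_real ((1 / 2) powr \<mu> / Gamma (\<mu> + 1) * 2) * bessel_discr \<mu>"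
proof -
  have \<mu>: "\<mu> > -1" "\<mu> + 1 > -1" using assms by auto
  define S where "S = (\<Sum>n. bessel_coeff \<mu> n)"
  define T where "T = (\<Sum>n. real n * bessel_coeff \<mu> n)"
  have ev: "(\<lambda>n. of_real (bessel_coeff \<nu> n)) sums eval_fps (bessel_fps \<nu>) 1" if "\<nu> > -1" for \<nu>
  proof -
    have "(\<lambda>n. fps_nth (bessel_fps \<nu>) n * 1 ^ n) sums eval_fps (bessel_fps \<nu>) 1"
      by (rule sums_eval_fps) (simp add: that)
    then show ?thesis by (simp add: bessel_fps_def)
  qed
  have evS: "summable (bessel_coeff \<nu>)" "eval_fps (bessel_fps \<nu>) 1 = of_real (\<Sum>n. bessel_coeff \<nu> n)"
    if "\<nu> > -1" for \<nu>
  proof -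
    show s: "summable (bessel_coeff \<nu>)" using sums_Re[OF ev[OF that]] by (simp add: sums_iff)
    show "eval_fps (bessel_fps \<nu>) 1 = of_real (\<Sum>n. bessel_coeff \<nu> n)"
      using ev[OF that] sums_of_real[OF summable_sums[OF s]] by (rule sums_unique2)
  qed
  have S: "bessel_coeff \<mu> sums S" unfolding S_def by (intro summable_sums evS \<mu>)
  \<comment> \<open>In terms of \<phi>, raising the order by one is differentiation, up to the
    factor -4 (\<mu> + 1).\<close>
  have shift: "bessel_coeff (\<mu> + 1) n = - 4 * (\<mu> + 1) * (real (Suc n) * bessel_coeff \<mu> (Suc n))" for n
  proof -
    have p: "pochhammer (\<mu> + 1) (Suc n) = (\<mu> + 1) * pochhammer (\<mu> + 1 + 1) n" by (rule pochhammer_rec)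
    have "pochhammer (\<mu> + 1 + 1) n > 0" using assms by (intro pochhammer_pos) auto
    then show ?thesis unfolding bessel_coeff_def p using assms by (simp add: divide_simps) (simp add: algebra_simps)
  qed
  have "(\<lambda>n. - 4 * (\<mu> + 1) * (real (Suc n) * bessel_coeff \<mu> (Suc n))) sums (\<Sum>n. bessel_coeff (\<mu> + 1) n)"
    unfolding shift[symmetric] by (intro summable_sums evS \<mu>)
  note sh = sums_mult[OF this, of "- 1 / (4 * (\<mu> + 1))"]
  have "(\<lambda>n. real (Suc n) * bessel_coeff \<mu> (Suc n)) sums (- 1 / (4 * (\<mu> + 1)) * (\<Sum>n. bessel_coeff (\<mu> + 1) n))"
  proof -
    have "- 1 / (4 * (\<mu> + 1)) * (- 4 * (\<mu> + 1) * a) = a" for a using \<mu> by (simp add: field_simps)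
    then show ?thesis using sh by (simp only:)
  qed
  then have T': "(\<lambda>n. real n * bessel_coeff \<mu> n) sums (- 1 / (4 * (\<mu> + 1)) * (\<Sum>n. bessel_coeff (\<mu> + 1) n))"
    by (subst (asm) sums_Suc_iff) simp
  then have T: "(\<lambda>n. real n * bessel_coeff \<mu> n) sums T" and Teq: "(\<Sum>n. bessel_coeff (\<mu> + 1) n) = - 4 * (\<mu> + 1) * T"
    using \<mu> unfolding T_def by (auto simp: sums_iff field_simps)
  have "(\<lambda>n. 4 * real (Suc n) * (real (Suc n) + \<mu>) * bessel_coeff \<mu> (Suc n)) sums (- S)"
    using sums_minus[OF S] bessel_coeff_Suc[OF \<mu>(1)] by (simp add: add_ac)
  then have "(\<lambda>n. 4 * real n * (real n + \<mu>) * bessel_coeff \<mu> n) sums (- S)"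
    by (subst (asm) sums_Suc_iff) simp
  \<comment> \<open>Here 2 (n + 1)(2n + 1) = 4 n (n + \<mu>) + (6 - 4 \<mu>) n + 2, whose three
    parts sum to -S, (6 - 4 \<mu>) T and 2 S.\<close>
  from sums_add[OF this sums_add[OF sums_mult[OF T, of "6 - 4 * \<mu>"] sums_mult[OF S, of 2]]]
  have "(\<lambda>n. 2 * ((real n + 1) * (2 * real n + 1) * bessel_coeff \<mu> n)) sums (S + (6 - 4 * \<mu>) * T)"
    by (simp add: algebra_simps)
  with sums_mult[OF bessel_discr_sums[OF \<mu>(1)], of 2]
  have D: "2 * Re (bessel_discr \<mu>) = S + (6 - 4 * \<mu>) * T" by (rule sums_unique2)
  have \<Gamma>: "Gamma (\<mu> + 1 + 1) = (\<mu> + 1) * Gamma (\<mu> + 1)" "Gamma (\<mu> + 1) > 0"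
  proof -
    have "\<mu> + 1 \<notin> \<int>\<^sub>\<le>\<^sub>0" using assms by (auto dest: nonpos_Ints_nonpos)
    then show "Gamma (\<mu> + 1 + 1) = (\<mu> + 1) * Gamma (\<mu> + 1)" by (rule Gamma_plus1)
    show "Gamma (\<mu> + 1) > 0" using assms by (intro Gamma_real_pos) auto
  qed
  have J: "bessel_J \<nu> 1 = of_real ((1 / 2) powr \<nu> * (\<Sum>n. bessel_coeff \<nu> n) / Gamma (\<nu> + 1))" if "\<nu> > -1" for \<nu>
    using powr_of_real[of "1 / 2" \<nu>] by (simp add: bessel_J_eq[OF that] evS[OF that])
  have real_eq: "(2 * \<mu> - 3) * ((1 / 2) powr (\<mu> + 1) * (- 4 * (\<mu> + 1) * T) / ((\<mu> + 1) * Gamma (\<mu> + 1)))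
      + (1 / 2) powr \<mu> * S / Gamma (\<mu> + 1) = (1 / 2) powr \<mu> / Gamma (\<mu> + 1) * (S + (6 - 4 * \<mu>) * T)"
  proof -
    have cancel: "(2 * \<mu> - 3) * (p / 2 * (- 4 * n * T) / (n * g)) + p * S / g = p / g * (S + (6 - 4 * \<mu>) * T)"
      if "g > 0" "n > 0" for p g n :: real
      using that by (simp add: field_simps)
    have half: "(1 / 2) powr (\<mu> + 1) = (1 / 2) powr \<mu> / 2" by (simp add: powr_add)
    show ?thesis unfolding half by (rule cancel[OF \<Gamma>(2)]) (use \<mu> in simp)
  qed
  have "of_real (2 * \<mu> - 3) * bessel_J (\<mu> + 1) 1 + bessel_J \<mu> 1
      = of_real ((1 / 2) powr \<mu> / Gamma (\<mu> + 1) * (S + (6 - 4 * \<mu>) * T))"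
    unfolding J[OF \<mu>(1)] J[OF \<mu>(2)] Teq S_def[symmetric] \<Gamma>(1) of_real_mult[symmetric] of_real_add[symmetric]
    by (simp only: real_eq)
  also have "\<dots> = of_real ((1 / 2) powr \<mu> / Gamma (\<mu> + 1) * 2 * Re (bessel_discr \<mu>))"
    by (simp add: D[symmetric])
  also have "\<dots> = of_real ((1 / 2) powr \<mu> / Gamma (\<mu> + 1) * 2) * bessel_discr \<mu>"
    using Im_bessel_discr[OF \<mu>(1)] by (simp add: complex_eq_iff)
  finally show ?thesis .
qed

text \<open>The threshold itself belongs to the uniformly convex range: there h'(1) + 2 h''(1) = 0,
  which still yields |h''/h'| \<le> 1/2, and the tangent angle is only required to be
  nondecreasing.\<close>

theorem theorem3p6:
  shows "\<exists>\<nu>\<^sub>3::real.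
    {\<mu>::real. 0 \<le> \<mu> \<and> of_real (2 * \<mu> - 3) * bessel_J (\<mu> + 1) 1 + bessel_J \<mu> 1 = 0} = {\<nu>\<^sub>3} \<and>
    \<bar>\<nu>\<^sub>3 - 0.30608\<bar> < 0.000005 \<and>
    (\<forall>\<nu>::real. \<nu> > -1 \<longrightarrow> (uniformly_convex (bessel_h \<nu>) \<longleftrightarrow> \<nu> \<ge> \<nu>\<^sub>3))"
proof -
  obtain r where r: "306075 / 1000000 < r" "r < 306085 / 1000000"
    and sgn: "\<And>\<nu>. \<nu> > -1 \<Longrightarrow> sgn (Re (bessel_discr \<nu>)) = sgn (\<nu> - r)"
    by (rule bessel_discr_root) blast
  have zero: "bessel_discr \<mu> = 0 \<longleftrightarrow> \<mu> = r" and nonneg: "Re (bessel_discr \<mu>) \<ge> 0 \<longleftrightarrow> \<mu> \<ge> r" if "\<mu> > -1" for \<mu>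
    using sgn[OF that] Im_bessel_discr[OF that] by (auto simp: complex_eq_iff sgn_if split: if_splits)
  have "of_real (2 * \<mu> - 3) * bessel_J (\<mu> + 1) 1 + bessel_J \<mu> 1 = 0 \<longleftrightarrow> \<mu> = r" if "\<mu> \<ge> 0" for \<mu>
  proof -
    have "Gamma (\<mu> + 1) > 0" using that by (intro Gamma_real_pos) auto
    then have "Gamma (\<mu> + 1) \<noteq> 0" by (rule less_imp_neq[symmetric])
    then show ?thesis unfolding bessel_J_discr[OF that] using zero[of \<mu>] that by simp
  qed
  then have "{\<mu>. 0 \<le> \<mu> \<and> of_real (2 * \<mu> - 3) * bessel_J (\<mu> + 1) 1 + bessel_J \<mu> 1 = 0} = {r}"
    using r by auto
  moreover have "\<bar>r - 0.30608\<bar> < 0.000005" using r by (simp add: abs_if)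
  moreover have "uniformly_convex (bessel_h \<nu>) \<longleftrightarrow> \<nu> \<ge> r" if \<nu>: "\<nu> > -1" for \<nu>
  proof
    assume uc: "uniformly_convex (bessel_h \<nu>)"
    have "Re (bessel_discr \<nu>) \<ge> 0"
      unfolding bessel_discr_def
    proof (rule uniformly_convex_imp_boundary[OF bessel_h_has_derivative[OF \<nu>]])
      show "isCont (eval_fps (fps_deriv (fps_deriv (bessel_h_fps \<nu>)))) 1"
        using \<nu> by (intro DERIV_isCont[OF has_field_derivative_eval_fps]) simp
    qed (use uc \<nu> in \<open>simp_all add: bessel_h_eq Im_bessel_h_deriv\<close>)
    then show "\<nu> \<ge> r" using nonneg \<nu> by simp
  next
    assume "\<nu> \<ge> r"
    then show "uniformly_convex (bessel_h \<nu>)"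
      using r nonneg[OF \<nu>] by (intro bessel_h_uniformly_convexI) (auto simp flip: bessel_discr_def)
  qed
  ultimately show ?thesis by blast
qed

end
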